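(* Let $\Sigma$ be a signed graph. Write its chromatic $B$-symmetric function $X_\Sigma$ as a polynomial with rational coefficients in the elements of the augmented elementary $B$-symmetric basis $\{e_n : n\ge 1\}\cup\{q_{a,b}: a,b\ge 1\}\cup\{z\}$. Then for every $k\ge 0$, the number of acyclic orientations of $\Sigma$ with exactly $k$ sinks equals the sum of the coefficients of those monomials that contain exactly $k$ factors of the form $e_n$ (counted with multiplicity).
   Context: A signed graph $\Sigma$ is a finite graph (loops and multiple edges allowed) together with a sign function $\mathrm{sgn}:E(\Sigma)\to\{+,-\}$; write $e:uv$ if $e$ has endpoints $u,v$ ($u=v$ for a loop). A coloring is a map $\kappa:V(\Sigma)\to\mathbb{Z}$; it is proper if $\kappa(u)\neq \mathrm{sgn}(e)\kappa(v)$ for every edge $e:uv$. The chromatic $B$-symmetric function is $X_\Sigma=\sum_{\kappa\text{ proper}}\prod_{v\in V(\Sigma)}x_{\kappa(v)}$, a formal power series in commuting variables $x_i$, $i\in\mathbb{Z}$. An orientation of $\Sigma$ assigns to each incidence of an edge with an endpoint (each half-edge; a loop has two) an arrow pointing toward or away from that vertex, such that on a positive edge exactly one of the two arrows points toward its vertex, and on a negative edge the two arrows either both point toward their vertices or both point away. A cycle is a closed walk such that, considering only the edges of the walk, every vertex of the walk has at least one arrow pointing into it and at least one pointing out of it; an orientation is acyclic if it has no cycle. A sink is a vertex all of whose incident arrows point toward it (an isolated vertex is a sink). Notation: $p_{a,b}=\sum_{i\in\mathbb{Z}}x_i^a x_{-i}^b$; $q_{a,b}=(-1)^{a+b+1}p_{a,b}$;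 $z=-x_0$; $e_n=\sum_{i_1<i_2<\dots<i_n,\ i_j\in\mathbb{Z}}x_{i_1}\cdots x_{i_n}$. The paper states that every chromatic $B$-symmetric function can be written uniquely as a polynomial in $\{e_n : n\ge1\}\cup\{q_{a,b}:a,b\ge1\}\cup\{z\}$. *)

theory Defs
  imports Complex_Main "HOL-Library.Multiset" "HOL-Library.FuncSet"
begin

text \<open>A monomial prod_v x_{c(v)} is represented by the multiset of its variable
indices; a formal power series (with rational coefficients) is its coefficient function.\<close>

type_synonym series = "int multiset \<Rightarrow> rat"

definition ser_mult :: "series \<Rightarrow> series \<Rightarrow> series" where
  "ser_mult f g = (\<lambda>m. \<Sum>A\<in>{A. A \<subseteq># m}. f A * g (m - A))"

fun ser_prod_list :: "series list \<Rightarrow> series" where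
  "ser_prod_list [] = (\<lambda>m. if m = {#} then 1 else 0)"
| "ser_prod_list (f # fs) = ser_mult f (ser_prod_list fs)"

definition e_ser :: "nat \<Rightarrow> series" where
  "e_ser n m = (if size m = n \<and> (\<forall>i. count m i \<le> 1) then 1 else 0)"

definition p_ser :: "nat \<Rightarrow> nat \<Rightarrow> series" where
  "p_ser a b m = of_nat (card {i::int. m = replicate_mset a i + replicate_mset b (- i)})"

definition q_ser :: "nat \<Rightarrow> nat \<Rightarrow> series" where
  "q_ser a b m = (-1) ^ (a + b + 1) * p_ser a b m"

definition z_ser :: series where
  "z_ser m = (if m = {#0#} then -1 else 0)"

datatype gen = GE nat | GQ nat nat | GZ

definition valid_gen :: "gen \<Rightarrow> bool" where
  "valid_gen g = (case g of GE n \<Rightarrow> 1 \<le> n | GQ a b \<Rightarrow> 1 \<le> a \<and> 1 \<le> b | GZ \<Rightarrow> True)"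

definition is_GE :: "gen \<Rightarrow> bool" where
  "is_GE g = (case g of GE n \<Rightarrow> True | _ \<Rightarrow> False)"

definition gen_ser :: "gen \<Rightarrow> series" where
  "gen_ser g = (case g of GE n \<Rightarrow> e_ser n | GQ a b \<Rightarrow> q_ser a b | GZ \<Rightarrow> z_ser)"

definition gen_mono_ser :: "gen multiset \<Rightarrow> series" where
  "gen_mono_ser M = ser_prod_list (map gen_ser (SOME xs. mset xs = M))"

text \<open>A polynomial is a finitely supported coefficient function on generator monomials.\<close>
definition poly_eval :: "(gen multiset \<Rightarrow> rat) \<Rightarrow> series" where
  "poly_eval P = (\<lambda>m. \<Sum>M\<in>{M. P M \<noteq> 0}. P M * gen_mono_ser M m)"

definition num_e :: "gen multiset \<Rightarrow> nat" where
  "num_e M = size (filter_mset is_GE M)"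

text \<open>Vertices V, edges E, endpoints ends e = (u,v) (u = v for a loop),
pos e = True iff the edge is positive. Half-edges are pairs (e,b): (e,True) is
the incidence at fst (ends e), (e,False) the incidence at snd (ends e).\<close>

definition signed_graph :: "'v set \<Rightarrow> 'e set \<Rightarrow> ('e \<Rightarrow> 'v \<times> 'v) \<Rightarrow> bool" where
  "signed_graph V E ends \<longleftrightarrow> finite V \<and> finite E \<and>
     (\<forall>e\<in>E. fst (ends e) \<in> V \<and> snd (ends e) \<in> V)"

definition proper_col :: "'e set \<Rightarrow> ('e \<Rightarrow> 'v \<times> 'v) \<Rightarrow> ('e \<Rightarrow> bool) \<Rightarrow> ('v \<Rightarrow> int) \<Rightarrow> bool" where
  "proper_col E ends pos \<kappa> \<longleftrightarrow>
     (\<forall>e\<in>E. \<kappa> (fst (ends e)) \<noteq> (if pos e then 1 else -1) * \<kappa> (snd (ends e)))"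

definition chrom_B :: "'v set \<Rightarrow> 'e set \<Rightarrow> ('e \<Rightarrow> 'v \<times> 'v) \<Rightarrow> ('e \<Rightarrow> bool) \<Rightarrow> series" where
  "chrom_B V E ends pos = (\<lambda>m. of_nat (card {\<kappa> \<in> V \<rightarrow>\<^sub>E (UNIV :: int set).
      proper_col E ends pos \<kappa> \<and> image_mset \<kappa> (mset_set V) = m}))"

definition hv :: "('e \<Rightarrow> 'v \<times> 'v) \<Rightarrow> 'e \<times> bool \<Rightarrow> 'v" where
  "hv ends h = (if snd h then fst (ends (fst h)) else snd (ends (fst h)))"

text \<open>An orientation: tau h = True iff the arrow at half-edge h points toward its vertex.\<close>
definition orientation :: "'e set \<Rightarrow> ('e \<Rightarrow> bool) \<Rightarrow> ('e \<times> bool \<Rightarrow> bool) \<Rightarrow> bool" where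
  "orientation E pos \<tau> \<longleftrightarrow> (\<forall>h. fst h \<notin> E \<longrightarrow> \<not> \<tau> h) \<and>
     (\<forall>e\<in>E. if pos e then \<tau> (e, True) \<noteq> \<tau> (e, False) else \<tau> (e, True) = \<tau> (e, False))"

definition closed_walk :: "'e set \<Rightarrow> ('e \<Rightarrow> 'v \<times> 'v) \<Rightarrow> 'e list \<Rightarrow> 'v list \<Rightarrow> bool" where
  "closed_walk E ends es vs \<longleftrightarrow> es \<noteq> [] \<and> length vs = length es \<and> set es \<subseteq> E \<and>
     (\<forall>i<length es. let x = vs ! i; y = vs ! ((i + 1) mod length es) in
        (fst (ends (es ! i)) = x \<and> snd (ends (es ! i)) = y) \<or>
        (fst (ends (es ! i)) = y \<and> snd (ends (es ! i)) = x))"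

definition is_cycle :: "'e set \<Rightarrow> ('e \<Rightarrow> 'v \<times> 'v) \<Rightarrow> ('e \<times> bool \<Rightarrow> bool) \<Rightarrow> 'e list \<Rightarrow> 'v list \<Rightarrow> bool" where
  "is_cycle E ends \<tau> es vs \<longleftrightarrow> closed_walk E ends es vs \<and>
     (\<forall>v\<in>set vs. (\<exists>h. fst h \<in> set es \<and> hv ends h = v \<and> \<tau> h) \<and>
                 (\<exists>h. fst h \<in> set es \<and> hv ends h = v \<and> \<not> \<tau> h))"

definition acyclic_ori :: "'e set \<Rightarrow> ('e \<Rightarrow> 'v \<times> 'v) \<Rightarrow> ('e \<Rightarrow> bool) \<Rightarrow> ('e \<times> bool \<Rightarrow> bool) \<Rightarrow> bool" where
  "acyclic_ori E ends pos \<tau> \<longleftrightarrow> orientation E pos \<tau> \<and> \<not> (\<exists>es vs. is_cycle E ends \<tau> es vs)"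

definition is_sink :: "'v set \<Rightarrow> 'e set \<Rightarrow> ('e \<Rightarrow> 'v \<times> 'v) \<Rightarrow> ('e \<times> bool \<Rightarrow> bool) \<Rightarrow> 'v \<Rightarrow> bool" where
  "is_sink V E ends \<tau> v \<longleftrightarrow> v \<in> V \<and> (\<forall>h. fst h \<in> E \<and> hv ends h = v \<longrightarrow> \<tau> h)"

definition num_sinks :: "'v set \<Rightarrow> 'e set \<Rightarrow> ('e \<Rightarrow> 'v \<times> 'v) \<Rightarrow> ('e \<times> bool \<Rightarrow> bool) \<Rightarrow> nat" where
  "num_sinks V E ends \<tau> = card {v \<in> V. is_sink V E ends \<tau> v}"

end

theory Submission
  imports Defs "HOL-Computational_Algebra.Polynomial"
begin

text \<open>
  Evaluate series at x_0 = -1, x_i = x_{-i} = -1 for 1 \<le> i \<le> n, x_{n+1} = t - 1, and all other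
  variables 0. The value of each generator is a polynomial in n; extrapolated to n = -1
  it becomes t for e_k and 1 for q_{a,b} and z, so a monomial M becomes t ^ num_e M. On the
  other side, removing the set S of vertices of colour n + 1 turns the value of the chromatic
  series into the sum of (t - 1)^|S| (-1)^|V - S| times the number of proper colourings of
  V - S in {-n..n}, over admissible S. At n = -1 the signed number of colourings becomes the
  number of acyclic orientations, and acyclic orientations of V - S correspond to those of V in
  which every vertex of S is a sink; so the sum over S is the sum of t ^ num_sinks.

  The value at n = -1 comes from comparing colourings in {-n-1..n+1} with those in {-n..n}: the
  vertices coloured n + 1 and -n-1 play the roles of prescribed sinks and sources, and the
  resulting difference equation has the same shape as inclusion-exclusion over sinks and sources,
  because every acyclic orientation of a nonempty edge set has a non-isolated sink or source.
\<close>

section \<open>Extrapolation of polynomial sequences to -1\<close>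

text \<open>As a relation it carries both the claim that \<open>f\<close> agrees with a polynomial
  at every natural number and the value of that polynomial at \<open>-1\<close>.\<close>

definition extrapolates :: "(nat \<Rightarrow> rat) \<Rightarrow> rat \<Rightarrow> bool" where
  "extrapolates f v \<longleftrightarrow> (\<exists>p. (\<forall>n. poly p (of_nat n) = f n) \<and> poly p (-1) = v)"

text \<open>Two interpolating polynomials agree at infinitely many points, so their difference
  vanishes. This allows two different computations of one sequence to be compared at
  \<open>-1\<close>.\<close>

lemma extrapolates_unique:
  assumes "extrapolates f v" "extrapolates f v'"
  shows "v = v'"
proof -
  obtain p q where p: "\<And>n. poly p (of_nat n) = f n" "poly p (-1) = v"
    and q: "\<And>n. poly q (of_nat n) = f n" "poly q (-1) = v'"
    using assms unfolding extrapolates_def by blast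
  have "range (of_nat :: nat \<Rightarrow> rat) \<subseteq> {x. poly (p - q) x = 0}"
    using p q by auto
  moreover have "infinite (range (of_nat :: nat \<Rightarrow> rat))"
    by (simp add: finite_image_iff inj_of_nat)
  ultimately have "infinite {x. poly (p - q) x = 0}"
    using finite_subset by blast
  then have "p - q = 0" using poly_roots_finite by blast
  then show ?thesis using p q by simp
qed

lemma extrapolates_const: "extrapolates (\<lambda>n. c) c"
  unfolding extrapolates_def by (rule exI[of _ "[:c:]"]) simp

text \<open>The sequence is the number of colours in \<open>{- int n..int n}\<close>, which becomes
  \<open>-1\<close> at \<open>n = -1\<close>.\<close>

lemma extrapolates_odd: "extrapolates (\<lambda>n. of_nat (2 * n + 1)) (-1)"
  unfolding extrapolates_def by (rule exI[of _ "[:1, 2:]"]) simp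

lemma extrapolates_add:
  assumes "extrapolates f v" "extrapolates g w"
  shows "extrapolates (\<lambda>n. f n + g n) (v + w)"
  using assms unfolding extrapolates_def by (metis poly_add)

lemma extrapolates_mult:
  assumes "extrapolates f v" "extrapolates g w"
  shows "extrapolates (\<lambda>n. f n * g n) (v * w)"
  using assms unfolding extrapolates_def by (metis poly_mult)

lemma extrapolates_sum:
  assumes "finite I" "\<And>i. i \<in> I \<Longrightarrow> extrapolates (f i) (v i)"
  shows "extrapolates (\<lambda>n. \<Sum>i\<in>I. f i n) (\<Sum>i\<in>I. v i)"
  using assms by (induction I rule: finite_induct)
    (simp_all add: extrapolates_const extrapolates_add)

lemma extrapolates_prod_list:
  assumes "\<And>x. x \<in> set xs \<Longrightarrow> extrapolates (f x) (v x)"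
  shows "extrapolates (\<lambda>n. prod_list (map (\<lambda>x. f x n) xs)) (prod_list (map v xs))"
  using assms by (induction xs)
    (simp_all add: extrapolates_const extrapolates_mult)

lemma extrapolates_gbinomial:
  assumes "extrapolates f v"
  shows "extrapolates (\<lambda>n. f n gchoose k) (v gchoose k)"
proof (induction k)
  case 0
  then show ?case by (simp add: extrapolates_const)
next
  case (Suc k)
  \<comment> \<open>This recursion multiplies by a linear factor in \<open>a\<close>, so closure
    under sums and products is all that the induction needs.\<close>
  have step: "a gchoose Suc k = (a gchoose k) * ((a + - of_nat k) * inverse (of_nat (Suc k)))"
    for a :: rat
    using gbinomial_absorption[of k a] gbinomial_absorb_comp[of a k]
    by (simp add: field_simps del: of_nat_Suc)
  show ?case unfolding step
    by (intro extrapolates_mult extrapolates_add extrapolates_const Suc assms)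
qed

section \<open>Discrete antiderivatives of polynomials\<close>

text \<open>By the binomial theorem the difference of \<open>x ^ (n + 1)\<close> is
  \<open>(n + 1) * x ^ n\<close> plus lower powers, whose antidifferences exist by strong induction
  and can be subtracted.\<close>

lemma power_antidifference:
  "\<exists>p :: rat poly. \<forall>x. poly p (x + 1) - poly p x = x ^ n"
proof (induction n rule: less_induct)
  case (less n)
  then obtain q :: "nat \<Rightarrow> rat poly"
    where q: "\<And>k x. k < n \<Longrightarrow> poly (q k) (x + 1) - poly (q k) x = x ^ k"
    by metis
  define p where "p = smult (1 / of_nat (n + 1))
    (monom 1 (n + 1) - (\<Sum>k<n. smult (of_nat ((n + 1) choose k)) (q k)))"
  have "poly p (x + 1) - poly p x = x ^ n" for x
  proof -
    have "(x + 1) ^ (n + 1) = (\<Sum>k\<le>n + 1. of_nat ((n + 1) choose k) * x ^ k)"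
      by (subst binomial_ring) simp
    also have "{..n + 1} = insert (n + 1) (insert n {..<n})" by auto
    finally have b: "(x + 1) ^ (n + 1) = x ^ (n + 1) + of_nat (n + 1) * x ^ n
        + (\<Sum>k<n. of_nat ((n + 1) choose k) * x ^ k)"
      by simp
    have "(\<Sum>k<n. of_nat ((n + 1) choose k) * poly (q k) (x + 1))
        - (\<Sum>k<n. of_nat ((n + 1) choose k) * poly (q k) x)
        = (\<Sum>k<n. of_nat ((n + 1) choose k) * x ^ k)"
      unfolding sum_subtractf[symmetric]
      by (intro sum.cong) (simp_all add: q[symmetric] right_diff_distrib)
    with b have "((x + 1) ^ (n + 1) - (\<Sum>k<n. of_nat ((n + 1) choose k) * poly (q k) (x + 1)))
        - (x ^ (n + 1) - (\<Sum>k<n. of_nat ((n + 1) choose k) * poly (q k) x))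
        = of_nat (n + 1) * x ^ n"
      by linarith
    moreover have "poly p (x + 1) - poly p x = 1 / of_nat (n + 1)
        * (((x + 1) ^ (n + 1) - (\<Sum>k<n. of_nat ((n + 1) choose k) * poly (q k) (x + 1)))
        - (x ^ (n + 1) - (\<Sum>k<n. of_nat ((n + 1) choose k) * poly (q k) x)))"
      unfolding p_def poly_smult poly_diff poly_sum poly_monom right_diff_distrib by simp
    ultimately show ?thesis by (simp del: of_nat_Suc of_nat_add)
  qed
  then show ?case by blast
qed

lemma poly_antidifference:
  "\<exists>p :: rat poly. \<forall>x. poly p (x + 1) - poly p x = poly q x"
proof -
  obtain r :: "nat \<Rightarrow> rat poly" where r: "\<And>k x. poly (r k) (x + 1) - poly (r k) x = x ^ k"
    using power_antidifference by metis
  have "poly (\<Sum>k\<le>degree q. smult (coeff q k) (r k)) (x + 1)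
      - poly (\<Sum>k\<le>degree q. smult (coeff q k) (r k)) x = poly q x" for x
    by (simp add: poly_altdef[of q] poly_sum sum_subtractf[symmetric] r
        flip: right_diff_distrib)
  then show ?thesis by blast
qed

text \<open>An antidifference \<open>p\<close> of the polynomial behind \<open>g\<close>, shifted to
  start at \<open>f 0\<close>, agrees with \<open>f\<close> by induction. Its step from
  \<open>-1\<close> to \<open>0\<close> is \<open>d\<close>, hence the value
  \<open>f 0 - d\<close>.\<close>

lemma extrapolates_antidifference:
  assumes "\<And>n. f (Suc n) - f n = g n" and "extrapolates g d"
  shows "extrapolates f (f 0 - d)"
proof -
  obtain q where q: "\<And>n. poly q (of_nat n) = g n" "poly q (-1) = d"
    using assms unfolding extrapolates_def by blast
  obtain p where p: "\<And>x. poly p (x + 1) - poly p x = poly q x"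
    using poly_antidifference by blast
  \<comment> \<open>Antidifferences are unique up to a constant; this one matches \<open>f\<close>
    at 0.\<close>
  define p' where "p' = p + [:f 0 - poly p 0:]"
  have p': "poly p' (x + 1) - poly p' x = poly q x" for x
    using p[of x] by (simp add: p'_def)
  have "poly p' (of_nat n) = f n" for n
  proof (induction n)
    case (Suc n)
    then show ?case using p'[of "of_nat n"] q(1)[of n] assms(1)[of n]
      by (simp add: add.commute)
  qed (simp add: p'_def)
  moreover have "poly p' (-1) = f 0 - d"
    using p'[of "-1"] q(2) by (simp add: p'_def)
  ultimately show ?thesis unfolding extrapolates_def by blast
qed

section \<open>Evaluation of series\<close>

definition msets_upto :: "int set \<Rightarrow> nat \<Rightarrow> int multiset set" where
  "msets_upto A N = {m. set_mset m \<subseteq> A \<and> size m \<le> N}"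

text \<open>The degree cutoff N only keeps the sum finite; it is harmless for homogeneous series of
  degree at most N.\<close>

definition ser_eval :: "int set \<Rightarrow> (int \<Rightarrow> rat) \<Rightarrow> nat \<Rightarrow> series \<Rightarrow> rat" where
  "ser_eval A w N f = (\<Sum>m\<in>msets_upto A N. f m * prod_mset (image_mset w m))"

definition homogeneous :: "nat \<Rightarrow> series \<Rightarrow> bool" where
  "homogeneous d f \<longleftrightarrow> (\<forall>m. f m \<noteq> 0 \<longrightarrow> size m = d)"

lemma finite_msets_upto:
  assumes "finite A"
  shows "finite (msets_upto A N)"
proof -
  have "msets_upto A N \<subseteq> mset ` {xs. set xs \<subseteq> A \<and> length xs \<le> N}"
  proof
    fix m assume "m \<in> msets_upto A N"
    then show "m \<in> mset ` {xs. set xs \<subseteq> A \<and> length xs \<le> N}"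
      using ex_mset[of m] by (auto simp: msets_upto_def)
  qed
  then show ?thesis
    using finite_lists_length_le[OF assms] finite_surj by blast
qed

lemma finite_submsets: "finite {B. B \<subseteq># (m :: int multiset)}"
proof -
  have "{B. B \<subseteq># m} \<subseteq> msets_upto (set_mset m) (size m)"
    by (auto simp: msets_upto_def size_mset_mono dest: mset_subset_eqD)
  then show ?thesis using finite_msets_upto[of "set_mset m"] finite_subset by blast
qed

lemma homogeneous_mult:
  assumes "homogeneous a f" "homogeneous b g"
  shows "homogeneous (a + b) (ser_mult f g)"
  unfolding homogeneous_def
proof (intro allI impI)
  fix m assume "ser_mult f g m \<noteq> 0"
  then obtain B where B: "B \<subseteq># m" "f B * g (m - B) \<noteq> 0"
    unfolding ser_mult_def by (metis (no_types, lifting) mem_Collect_eq sum.neutral)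
  then have "size B = a" "size (m - B) = b"
    using assms unfolding homogeneous_def by auto
  moreover have "size m = size B + size (m - B)"
    using B(1) by (metis size_union subset_mset.add_diff_inverse)
  ultimately show "size m = a + b" by simp
qed

text \<open>Truncation at degree \<open>N\<close> is not multiplicative in general, since a product
  of two kept monomials may exceed \<open>N\<close>. The bound on \<open>a + b\<close> excludes this
  for homogeneous factors.\<close>

lemma ser_eval_mult:
  assumes "finite A" and f: "homogeneous a f" and g: "homogeneous b g" and "a + b \<le> N"
  shows "ser_eval A w N (ser_mult f g) = ser_eval A w N f * ser_eval A w N g"
proof -
  let ?M = "msets_upto A N" and ?W = "\<lambda>m. prod_mset (image_mset w m)"
  define T where "T = {(B, C). B \<in> ?M \<and> C \<in> ?M \<and> size B + size C \<le> N}"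
  have "ser_eval A w N f * ser_eval A w N g
      = (\<Sum>(B, C)\<in>?M \<times> ?M. (f B * ?W B) * (g C * ?W C))"
    unfolding ser_eval_def by (simp add: sum_product sum.cartesian_product)
  also have "\<dots> = (\<Sum>(B, C)\<in>T. (f B * ?W B) * (g C * ?W C))"
  \<comment> \<open>A pair outside \<open>T\<close> has total size above \<open>N\<close>, hence
    above \<open>a + b\<close>, so one of its two coefficients is zero.\<close>
  proof (rule sum.mono_neutral_right)
    show "\<forall>x\<in>?M \<times> ?M - T. (case x of (B, C) \<Rightarrow> (f B * ?W B) * (g C * ?W C)) = 0"
      using assms unfolding T_def homogeneous_def by fastforce
  qed (use finite_msets_upto[OF assms(1)] in \<open>auto simp: T_def\<close>)
  also have "\<dots> = (\<Sum>(m, B)\<in>Sigma ?M (\<lambda>m. {B. B \<subseteq># m}). f B * g (m - B) * ?W m)"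
  proof (rule sum.reindex_bij_witness[where i = "\<lambda>(m, B). (B, m - B)" and j = "\<lambda>(B, C). (B + C, B)"])
    fix x assume "x \<in> Sigma ?M (\<lambda>m. {B. B \<subseteq># m})"
    then obtain m B where x: "x = (m, B)" "m \<in> ?M" "B \<subseteq># m" by auto
    then obtain C where C: "m = B + C" by (auto simp: mset_subset_eq_exists_conv)
    show "(case case x of (m, B) \<Rightarrow> (B, m - B) of (B, C) \<Rightarrow> (B + C, B)) = x"
      using x C by simp
    show "(case x of (m, B) \<Rightarrow> (B, m - B)) \<in> T"
      using x C by (auto simp: T_def msets_upto_def)
  qed (auto simp: T_def msets_upto_def algebra_simps)
  also have "\<dots> = (\<Sum>m\<in>?M. \<Sum>B\<in>{B. B \<subseteq># m}. f B * g (m - B) * ?W m)"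
    using finite_msets_upto[OF assms(1)] finite_submsets by (subst sum.Sigma) auto
  also have "\<dots> = ser_eval A w N (ser_mult f g)"
    unfolding ser_eval_def ser_mult_def by (simp add: sum_distrib_right)
  finally show ?thesis by simp
qed

text \<open>Homogeneity of the product belongs to the conclusion because the induction step applies
  \<open>ser_eval_mult\<close> to the tail.\<close>

lemma ser_eval_prod_list:
  assumes "finite A" and "\<And>g. g \<in> set gs \<Longrightarrow> homogeneous (d g) (F g)"
    and "sum_list (map d gs) \<le> N"
  shows "homogeneous (sum_list (map d gs)) (ser_prod_list (map F gs))
    \<and> ser_eval A w N (ser_prod_list (map F gs)) = prod_list (map (\<lambda>g. ser_eval A w N (F g)) gs)"
  using assms(2,3)
proof (induction gs)
  case Nil
  have "(\<Sum>m\<in>msets_upto A N. (if m = {#} then 1 else 0) * prod_mset (image_mset w m))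
      = (\<Sum>m\<in>msets_upto A N. if m = {#} then 1 else 0)"
    by (intro sum.cong) auto
  also have "\<dots> = 1"
    using finite_msets_upto[OF assms(1)] by (simp add: sum.delta) (simp add: msets_upto_def)
  finally show ?case by (simp add: homogeneous_def ser_eval_def)
next
  case (Cons g gs)
  then show ?case
    using homogeneous_mult[of "d g" "F g" "sum_list (map d gs)" "ser_prod_list (map F gs)"]
      ser_eval_mult[OF assms(1), of "d g" "F g" "sum_list (map d gs)" "ser_prod_list (map F gs)" N w]
    by simp
qed

section \<open>Values of the generators\<close>

lemma ser_eval_e:
  assumes "finite A" "k \<le> N"
  shows "ser_eval A w N (e_ser k) = (\<Sum>S\<in>{S. S \<subseteq> A \<and> card S = k}. \<Prod>i\<in>S. w i)"
proof -
  have "ser_eval A w N (e_ser k)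
      = (\<Sum>m\<in>{m \<in> msets_upto A N. size m = k \<and> (\<forall>i. count m i \<le> 1)}. prod_mset (image_mset w m))"
    unfolding ser_eval_def e_ser_def using finite_msets_upto[OF assms(1)]
    by (intro sum.mono_neutral_cong_right) auto
  also have "\<dots> = (\<Sum>S\<in>{S. S \<subseteq> A \<and> card S = k}. \<Prod>i\<in>S. w i)"
  \<comment> \<open>Multisets without repeated entries are the same thing as finite sets.\<close>
  proof (rule sum.reindex_bij_witness[where i = mset_set and j = set_mset])
    fix m :: "int multiset" assume m: "m \<in> {m \<in> msets_upto A N. size m = k \<and> (\<forall>i. count m i \<le> 1)}"
    have "count (mset_set (set_mset m)) i = count m i" for i
      using m by (cases "i \<in># m") (auto simp: not_in_iff le_antisym Suc_leI)
    then show eq: "mset_set (set_mset m) = m" by (rule multiset_eqI)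
    show "set_mset m \<in> {S. S \<subseteq> A \<and> card S = k}"
      using m arg_cong[OF eq, of size] by (simp add: msets_upto_def)
    show "(\<Prod>i\<in>set_mset m. w i) = prod_mset (image_mset w m)"
      using arg_cong[OF eq, of "\<lambda>x. prod_mset (image_mset w x)"]
      by (simp add: prod_unfold_prod_mset)
  next
    fix S :: "int set" assume S: "S \<in> {S. S \<subseteq> A \<and> card S = k}"
    then have fin: "finite S" using assms(1) finite_subset by auto
    then show "set_mset (mset_set S) = S" by simp
    show "mset_set S \<in> {m \<in> msets_upto A N. size m = k \<and> (\<forall>i. count m i \<le> 1)}"
      using S fin assms(2) by (auto simp: msets_upto_def count_mset_set')
  qed
  finally show ?thesis .
qed

text \<open>The usual recurrence for elementary symmetric polynomials when a variable is added: the
  subsets are split by whether they contain \<open>s\<close>.\<close>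

lemma sum_subsets_insert:
  fixes w :: "'a \<Rightarrow> rat"
  assumes "finite B" "s \<notin> B"
  shows "(\<Sum>S\<in>{S. S \<subseteq> insert s B \<and> card S = Suc j}. \<Prod>i\<in>S. w i)
    = (\<Sum>S\<in>{S. S \<subseteq> B \<and> card S = Suc j}. \<Prod>i\<in>S. w i)
      + w s * (\<Sum>S\<in>{S. S \<subseteq> B \<and> card S = j}. \<Prod>i\<in>S. w i)"
proof -
  have inj: "inj_on (insert s) {S. S \<subseteq> B \<and> card S = j}"
    using assms(2) by (intro inj_onI) (metis (no_types, lifting) insert_ident mem_Collect_eq subsetD)
  have eq: "{S. S \<subseteq> insert s B \<and> card S = Suc j}
      = {S. S \<subseteq> B \<and> card S = Suc j} \<union> insert s ` {S. S \<subseteq> B \<and> card S = j}"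
  proof (intro equalityI subsetI)
    fix S assume S: "S \<in> {S. S \<subseteq> insert s B \<and> card S = Suc j}"
    show "S \<in> {S. S \<subseteq> B \<and> card S = Suc j} \<union> insert s ` {S. S \<subseteq> B \<and> card S = j}"
    proof (cases "s \<in> S")
      case True
      then have "S = insert s (S - {s})" "S - {s} \<subseteq> B" "card (S - {s}) = j"
        using S by auto
      then show ?thesis by blast
    qed (use S in auto)
  next
    fix S assume "S \<in> {S. S \<subseteq> B \<and> card S = Suc j} \<union> insert s ` {S. S \<subseteq> B \<and> card S = j}"
    then show "S \<in> {S. S \<subseteq> insert s B \<and> card S = Suc j}"
      using assms by (auto simp: card_insert_if finite_subset)
  qed
  have "(\<Sum>S\<in>insert s ` {S. S \<subseteq> B \<and> card S = j}. \<Prod>i\<in>S. w i)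
      = w s * (\<Sum>S\<in>{S. S \<subseteq> B \<and> card S = j}. \<Prod>i\<in>S. w i)"
    unfolding sum_distrib_left sum.reindex[OF inj]
  proof (intro sum.cong refl)
    fix S assume "S \<in> {S. S \<subseteq> B \<and> card S = j}"
    then have "finite S" "s \<notin> S" using assms finite_subset by auto
    then show "((\<lambda>S. \<Prod>i\<in>S. w i) \<circ> insert s) S = w s * (\<Prod>i\<in>S. w i)" by simp
  qed
  moreover have "{S. S \<subseteq> B \<and> card S = Suc j} \<inter> insert s ` {S. S \<subseteq> B \<and> card S = j} = {}"
    using assms(2) by auto
  ultimately show ?thesis
    unfolding eq using assms(1) by (subst sum.union_disjoint) auto
qed

text \<open>With all variables of \<open>B\<close> equal to \<open>-1\<close>, each
  \<open>l\<close>-subset of \<open>B\<close> has weight \<open>(-1) ^ l\<close>; the recurrence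
  then adds the one exceptional variable \<open>s\<close>.\<close>

lemma ser_eval_e_special:
  assumes "finite B" "s \<notin> B" "Suc j \<le> N" "\<And>i. i \<in> B \<Longrightarrow> w i = -1"
  shows "ser_eval (insert s B) w N (e_ser (Suc j))
    = (-1) ^ Suc j * of_nat (card B choose Suc j) + w s * ((-1) ^ j * of_nat (card B choose j))"
proof -
  have "(\<Sum>S\<in>{S. S \<subseteq> B \<and> card S = l}. \<Prod>i\<in>S. w i) = (-1) ^ l * of_nat (card B choose l)" for l
  proof -
    have "(\<Sum>S\<in>{S. S \<subseteq> B \<and> card S = l}. \<Prod>i\<in>S. w i) = (\<Sum>S\<in>{S. S \<subseteq> B \<and> card S = l}. (-1) ^ l)"
    proof (intro sum.cong refl)
      fix S assume S: "S \<in> {S. S \<subseteq> B \<and> card S = l}"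
      then have "(\<Prod>i\<in>S. w i) = (\<Prod>i\<in>S. -1)"
        using assms(4) by (intro prod.cong) auto
      then show "(\<Prod>i\<in>S. w i) = (-1) ^ l" using S by simp
    qed
    then show ?thesis using n_subsets[OF assms(1), of l] by simp
  qed
  then show ?thesis
    using assms by (simp add: ser_eval_e sum_subsets_insert)
qed

lemma ser_eval_q:
  assumes "finite A" "a + b \<le> N" "1 \<le> a" "1 \<le> b"
  shows "ser_eval A w N (q_ser a b)
    = (-1) ^ (a + b + 1) * (\<Sum>i\<in>{i \<in> A. - i \<in> A}. w i ^ a * w (- i) ^ b)"
proof -
  define \<mu> where "\<mu> i = replicate_mset a i + replicate_mset b (- i)" for i :: int
  let ?W = "\<lambda>m. prod_mset (image_mset w m)" and ?I = "{i \<in> A. - i \<in> A}"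
  have W: "?W (\<mu> i) = w i ^ a * w (- i) ^ b" for i by (simp add: \<mu>_def)
  have set_\<mu>: "set_mset (\<mu> i) = {i, - i}" for i using assms(3,4) by (auto simp: \<mu>_def)
  have "ser_eval A w N (q_ser a b)
      = (-1) ^ (a + b + 1) * (\<Sum>m\<in>msets_upto A N. of_nat (card {i. m = \<mu> i}) * ?W m)"
    unfolding ser_eval_def q_ser_def p_ser_def \<mu>_def sum_distrib_left
    by (simp add: mult.assoc)
  \<comment> \<open>Since \<open>a\<close> and \<open>b\<close> are positive, \<open>\<mu> i\<close>
    contains both \<open>i\<close> and \<open>- i\<close>, so the indices producing a multiset over
    \<open>A\<close> lie in \<open>?I\<close>. Regrouping then trades monomials for indices.\<close>
  also have "(\<Sum>m\<in>msets_upto A N. of_nat (card {i. m = \<mu> i}) * ?W m)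
      = (\<Sum>m\<in>msets_upto A N. \<Sum>i\<in>{i \<in> ?I. \<mu> i = m}. ?W (\<mu> i))"
  proof (intro sum.cong refl)
    fix m assume m: "m \<in> msets_upto A N"
    have "{i. m = \<mu> i} = {i \<in> ?I. \<mu> i = m}"
      using m set_\<mu> by (fastforce simp: msets_upto_def)
    then show "of_nat (card {i. m = \<mu> i}) * ?W m = (\<Sum>i\<in>{i \<in> ?I. \<mu> i = m}. ?W (\<mu> i))"
      by simp
  qed
  also have "\<dots> = (\<Sum>i\<in>?I. ?W (\<mu> i))"
    using assms by (intro sum.group finite_msets_upto)
      (auto simp: msets_upto_def set_\<mu>, simp add: \<mu>_def)
  finally show ?thesis by (simp add: W)
qed

lemma ser_eval_z:
  assumes "finite A" "0 \<in> A" "1 \<le> N"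
  shows "ser_eval A w N z_ser = - w 0"
proof -
  have "ser_eval A w N z_ser = (\<Sum>m\<in>msets_upto A N. if m = {#0#} then - w 0 else 0)"
    unfolding ser_eval_def z_ser_def by (intro sum.cong) auto
  then show ?thesis
    using assms finite_msets_upto[OF assms(1)] by (simp add: sum.delta) (simp add: msets_upto_def)
qed

fun gen_deg :: "gen \<Rightarrow> nat" where
  "gen_deg (GE n) = n"
| "gen_deg (GQ a b) = a + b"
| "gen_deg GZ = 1"

lemma homogeneous_gen: "homogeneous (gen_deg g) (gen_ser g)"
proof (cases g)
  case (GQ a b)
  have "size m = a + b" if "q_ser a b m \<noteq> 0" for m
  proof -
    have "{i::int. m = replicate_mset a i + replicate_mset b (- i)} \<noteq> {}"
      using that by (intro notI) (simp add: q_ser_def p_ser_def)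
    then show ?thesis by auto
  qed
  then show ?thesis by (simp add: GQ homogeneous_def gen_ser_def)
qed (auto simp: homogeneous_def gen_ser_def e_ser_def z_ser_def split: if_splits)

text \<open>The index - (n + 1) is absent from the alphabet, which amounts to setting its variable to 0.\<close>

definition pt :: "rat \<Rightarrow> nat \<Rightarrow> int \<Rightarrow> rat" where
  "pt t n i = (if i = int n + 1 then t - 1 else -1)"

definition alph :: "nat \<Rightarrow> int set" where
  "alph n = insert (int n + 1) {- int n..int n}"

text \<open>At \<open>n = -1\<close> the count \<open>2 * n + 1\<close> becomes \<open>-1\<close>,
  and \<open>-1 gchoose l\<close> is \<open>(-1) ^ l\<close>. So a generator \<open>GE\<close> gives
  \<open>1 + (t - 1) = t\<close>, while \<open>GQ\<close> has value \<open>- (2 * n + 1)\<close>,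
  which becomes 1, and \<open>GZ\<close> is constantly 1.\<close>

lemma extrapolates_gen:
  assumes "valid_gen g" "gen_deg g \<le> N"
  shows "extrapolates (\<lambda>n. ser_eval (alph n) (pt t n) N (gen_ser g)) (if is_GE g then t else 1)"
proof (cases g)
  case (GE k)
  then obtain j where k: "k = Suc j" using assms by (cases k) (auto simp: valid_gen_def)
  have "ser_eval (alph n) (pt t n) N (e_ser (Suc j))
      = (-1) ^ Suc j * (of_nat (2 * n + 1) gchoose Suc j)
        + (t - 1) * ((-1) ^ j * (of_nat (2 * n + 1) gchoose j))" for n
  proof -
    have card: "card {- int n..int n} = 2 * n + 1" by simp
    show ?thesis
      using assms GE k unfolding alph_def
      by (subst ser_eval_e_special) (auto simp: pt_def, simp only: card binomial_gbinomial flip: of_nat_Suc, simp add: add.commute)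
  qed
  moreover have "extrapolates (\<lambda>n. (-1) ^ Suc j * (of_nat (2 * n + 1) gchoose Suc j)
        + (t - 1) * ((-1) ^ j * (of_nat (2 * n + 1) gchoose j)))
      ((-1) ^ Suc j * ((-1) gchoose Suc j) + (t - 1) * ((-1) ^ j * ((-1) gchoose j)))"
    by (intro extrapolates_add extrapolates_mult extrapolates_const
        extrapolates_gbinomial extrapolates_odd)
  moreover have "(-1 gchoose l) = ((-1) ^ l :: rat)" for l
    using gbinomial_minus[of "1::rat" l] by (simp flip: binomial_gbinomial)
  ultimately show ?thesis using GE k
    by (simp add: gen_ser_def is_GE_def flip: power_mult_distrib)
next
  case (GQ a b)
  have "ser_eval (alph n) (pt t n) N (q_ser a b) = - 1 * of_nat (2 * n + 1)" for n
  proof -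
    \<comment> \<open>The colour \<open>n + 1\<close> has no negative in the alphabet, so
      \<open>t\<close> does not enter the value of \<open>q_ser\<close>.\<close>
    have "{i \<in> alph n. - i \<in> alph n} = {- int n..int n}" by (auto simp: alph_def)
    moreover have "(\<Sum>i\<in>{- int n..int n}. pt t n i ^ a * pt t n (- i) ^ b)
        = (\<Sum>i\<in>{- int n..int n}. (-1) ^ (a + b))"
      by (intro sum.cong) (auto simp: pt_def power_add)
    moreover have "finite (alph n)" by (simp add: alph_def)
    ultimately show ?thesis
      using assms GQ by (simp add: ser_eval_q valid_gen_def flip: power_mult_distrib)
        (simp add: algebra_simps flip: power_add)
  qed
  moreover have "extrapolates (\<lambda>n. - 1 * of_nat (2 * n + 1)) (- 1 * (- 1))"
    by (intro extrapolates_mult extrapolates_const extrapolates_odd)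
  ultimately show ?thesis using GQ by (simp add: gen_ser_def is_GE_def)
next
  case GZ
  have "ser_eval (alph n) (pt t n) N z_ser = 1" for n
    using assms GZ by (subst ser_eval_z) (auto simp: alph_def pt_def)
  then show ?thesis using GZ by (simp add: gen_ser_def is_GE_def extrapolates_const)
qed

definition mono_deg :: "gen multiset \<Rightarrow> nat" where
  "mono_deg M = sum_mset (image_mset gen_deg M)"

lemma extrapolates_gen_mono:
  assumes "\<forall>g\<in>#M. valid_gen g" "mono_deg M \<le> N"
  shows "extrapolates (\<lambda>n. ser_eval (alph n) (pt t n) N (gen_mono_ser M)) (t ^ num_e M)"
proof -
  \<comment> \<open>Whichever enumeration of \<open>M\<close> is chosen, each \<open>GE\<close>
    entry contributes \<open>t\<close> and every other entry 1.\<close>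
  define gs where "gs = (SOME xs. mset xs = M)"
  have gs: "mset gs = M" unfolding gs_def by (rule someI_ex) (rule ex_mset)
  have deg: "sum_list (map gen_deg gs) \<le> N"
    using assms(2) unfolding mono_deg_def gs[symmetric]
    by (simp add: sum_mset_sum_list flip: mset_map)
  have "ser_eval (alph n) (pt t n) N (gen_mono_ser M)
      = prod_list (map (\<lambda>g. ser_eval (alph n) (pt t n) N (gen_ser g)) gs)" for n
    unfolding gen_mono_ser_def gs_def[symmetric]
    using ser_eval_prod_list[of "alph n" gs gen_deg gen_ser N "pt t n"] deg homogeneous_gen
    by (auto simp: alph_def)
  moreover have "extrapolates
      (\<lambda>n. prod_list (map (\<lambda>g. ser_eval (alph n) (pt t n) N (gen_ser g)) gs))
      (prod_list (map (\<lambda>g. if is_GE g then t else 1) gs))"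
  proof (rule extrapolates_prod_list, rule extrapolates_gen)
    fix g assume g: "g \<in> set gs"
    then show "valid_gen g" using assms(1) gs by auto
    show "gen_deg g \<le> N" using g deg member_le_sum_list[of "gen_deg g" "map gen_deg gs"] by auto
  qed
  moreover have "prod_list (map (\<lambda>g. if is_GE g then t else 1) gs) = t ^ num_e M"
    unfolding num_e_def gs[symmetric] by (induction gs) auto
  ultimately show ?thesis by simp
qed

section \<open>Colourings\<close>

definition col_sum ::
  "'v set \<Rightarrow> 'e set \<Rightarrow> ('e \<Rightarrow> 'v \<times> 'v) \<Rightarrow> ('e \<Rightarrow> bool) \<Rightarrow> int set \<Rightarrow> (int \<Rightarrow> rat) \<Rightarrow> rat" where
  "col_sum V E ends pos A w =
    (\<Sum>\<kappa>\<in>{\<kappa> \<in> V \<rightarrow>\<^sub>E A. proper_col E ends pos \<kappa>}. \<Prod>v\<in>V. w (\<kappa> v))"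

text \<open>The constant weight \<open>-1\<close> makes this \<open>(-1) ^ card V\<close> times the
  number of proper colourings with colours in \<open>{- int n..int n}\<close>; that sign is the one
  of reciprocity.\<close>

definition signed_col_count ::
  "'v set \<Rightarrow> 'e set \<Rightarrow> ('e \<Rightarrow> 'v \<times> 'v) \<Rightarrow> ('e \<Rightarrow> bool) \<Rightarrow> nat \<Rightarrow> rat" where
  "signed_col_count V E ends pos n = col_sum V E ends pos {- int n..int n} (\<lambda>_. -1)"

text \<open>Colourings are grouped by their monomial, which alone determines the weight. Every such
  monomial has degree \<open>card V\<close>, so it survives the cutoff.\<close>

lemma ser_eval_chrom:
  assumes "finite V" "finite A" "card V \<le> N"
  shows "ser_eval A w N (chrom_B V E ends pos) = col_sum V E ends pos A w"
proof -
  let ?K = "{\<kappa> \<in> V \<rightarrow>\<^sub>E A. proper_col E ends pos \<kappa>}"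
  let ?im = "\<lambda>\<kappa>. image_mset \<kappa> (mset_set V)"
  have fin: "finite ?K" using assms by (simp add: finite_PiE)
  have "ser_eval A w N (chrom_B V E ends pos)
      = (\<Sum>m\<in>msets_upto A N. \<Sum>\<kappa>\<in>{\<kappa> \<in> ?K. ?im \<kappa> = m}. \<Prod>v\<in>V. w (\<kappa> v))"
    unfolding ser_eval_def
  proof (intro sum.cong refl)
    fix m assume m: "m \<in> msets_upto A N"
    have eq: "{\<kappa> \<in> V \<rightarrow>\<^sub>E UNIV. proper_col E ends pos \<kappa> \<and> ?im \<kappa> = m} = {\<kappa> \<in> ?K. ?im \<kappa> = m}"
      using m assms(1) by (fastforce simp: msets_upto_def PiE_iff)
    have "(\<Sum>\<kappa>\<in>{\<kappa> \<in> ?K. ?im \<kappa> = m}. \<Prod>v\<in>V. w (\<kappa> v))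
        = (\<Sum>\<kappa>\<in>{\<kappa> \<in> ?K. ?im \<kappa> = m}. prod_mset (image_mset w m))"
      by (intro sum.cong) (auto simp: prod_unfold_prod_mset image_mset.compositionality comp_def)
    then show "chrom_B V E ends pos m * prod_mset (image_mset w m)
        = (\<Sum>\<kappa>\<in>{\<kappa> \<in> ?K. ?im \<kappa> = m}. \<Prod>v\<in>V. w (\<kappa> v))"
      by (simp add: chrom_B_def eq)
  qed
  also have "\<dots> = col_sum V E ends pos A w"
    unfolding col_sum_def using assms fin finite_msets_upto[OF assms(2)]
    by (intro sum.group) (auto simp: msets_upto_def PiE_iff)
  finally show ?thesis .
qed

section \<open>Splitting off the extreme colours\<close>

definition del_verts :: "('e \<Rightarrow> 'v \<times> 'v) \<Rightarrow> 'v set \<Rightarrow> 'e set \<Rightarrow> 'e set" where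
  "del_verts ends S E = {e \<in> E. fst (ends e) \<notin> S \<and> snd (ends e) \<notin> S}"

definition supp :: "'v set \<Rightarrow> ('v \<Rightarrow> int) \<Rightarrow> 'v set" where
  "supp V \<sigma> = {v \<in> V. \<sigma> v \<noteq> 0}"

text \<open>This is properness of the extreme colours \<open>(n + 1) * \<sigma> v\<close>, tested
  only on edges with both ends labelled; the common factor \<open>n + 1\<close> cancels.\<close>

definition proper_label :: "'e set \<Rightarrow> ('e \<Rightarrow> 'v \<times> 'v) \<Rightarrow> ('e \<Rightarrow> bool) \<Rightarrow> ('v \<Rightarrow> int) \<Rightarrow> bool" where
  "proper_label E ends pos \<sigma> \<longleftrightarrow> (\<forall>e\<in>E. \<sigma> (fst (ends e)) \<noteq> 0 \<longrightarrow> \<sigma> (snd (ends e)) \<noteq> 0 \<longrightarrow>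
     \<sigma> (fst (ends e)) \<noteq> (if pos e then 1 else -1) * \<sigma> (snd (ends e)))"

lemma signed_graph_del_verts:
  "signed_graph V E ends \<Longrightarrow> signed_graph (V - S) (del_verts ends S E) ends"
  by (auto simp: signed_graph_def del_verts_def)

text \<open>An edge with one labelled end joins colours of absolute value \<open>n + 1\<close> and
  at most \<open>n\<close>, so it is never violated. The other edges split into those inside the
  support and those avoiding it.\<close>

lemma proper_col_join:
  assumes sg: "signed_graph V E ends"
    and \<sigma>: "\<And>v. v \<in> V \<Longrightarrow> \<sigma> v \<in> {0, 1, -1}"
    and \<kappa>: "\<And>v. v \<in> V \<Longrightarrow> \<sigma> v = 0 \<Longrightarrow> \<kappa> v \<in> {- int n..int n}"
    and \<kappa>': "\<And>v. v \<in> V \<Longrightarrow> \<sigma> v \<noteq> 0 \<Longrightarrow> \<kappa> v = (int n + 1) * \<sigma> v"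
  shows "proper_col E ends pos \<kappa> \<longleftrightarrow>
    proper_label E ends pos \<sigma> \<and> proper_col (del_verts ends (supp V \<sigma>) E) ends pos \<kappa>"
proof -
  have "\<kappa> u \<noteq> (if pos e then 1 else -1) * \<kappa> v \<longleftrightarrow>
      (\<sigma> u \<noteq> 0 \<longrightarrow> \<sigma> v \<noteq> 0 \<longrightarrow> \<sigma> u \<noteq> (if pos e then 1 else -1) * \<sigma> v) \<and>
      (\<sigma> u = 0 \<and> \<sigma> v = 0 \<longrightarrow> \<kappa> u \<noteq> (if pos e then 1 else -1) * \<kappa> v)"
    if "u \<in> V" "v \<in> V" for e u v
    using \<sigma>[OF that(1)] \<sigma>[OF that(2)] \<kappa>[OF that(1)] \<kappa>[OF that(2)] \<kappa>'[OF that(1)] \<kappa>'[OF that(2)]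
    by (cases "\<sigma> u = 0"; cases "\<sigma> v = 0"; cases "pos e") auto
  then show ?thesis
    using sg unfolding proper_col_def proper_label_def del_verts_def supp_def signed_graph_def
    by fastforce
qed

text \<open>The label of a vertex is 1 or -1 if its colour is n + 1 or -n-1, and 0 otherwise. Edges
  between a labelled and an unlabelled vertex impose no condition.\<close>

lemma col_sum_peel:
  fixes w :: "int \<Rightarrow> rat"
  assumes sg: "signed_graph V E ends" and L: "L \<subseteq> {1, -1}"
    and small: "\<And>i. i \<in> {- int n..int n} \<Longrightarrow> w i = -1"
    and big: "\<And>l. l \<in> L \<Longrightarrow> w ((int n + 1) * l) = r"
  shows "col_sum V E ends pos ({- int n..int n} \<union> (*) (int n + 1) ` L) w
    = (\<Sum>\<sigma>\<in>{\<sigma> \<in> V \<rightarrow>\<^sub>E insert 0 L. proper_label E ends pos \<sigma>}.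
        r ^ card (supp V \<sigma>)
        * signed_col_count (V - supp V \<sigma>) (del_verts ends (supp V \<sigma>) E) ends pos n)"
proof -
  let ?B = "{- int n..int n}" and ?N = "int n + 1"
  let ?A = "?B \<union> (*) ?N ` L"
  \<comment> \<open>\<open>lab\<close> reads off the label, and \<open>join\<close> puts the extreme
    colours back. Paired with restriction to the unlabelled vertices, they give mutually inverse
    maps.\<close>
  define lab where "lab \<kappa> = (\<lambda>v\<in>V. if \<kappa> v \<in> ?B then 0 else sgn (\<kappa> v))" for \<kappa> :: "'a \<Rightarrow> int"
  define join where "join \<sigma> \<kappa> = (\<lambda>v\<in>V. if \<sigma> v \<noteq> 0 then ?N * \<sigma> v else \<kappa> v)" for \<sigma> \<kappa> :: "'a \<Rightarrow> int"
  let ?\<Sigma> = "{\<sigma> \<in> V \<rightarrow>\<^sub>E insert 0 L. proper_label E ends pos \<sigma>}"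
  let ?K = "\<lambda>\<sigma>. {\<kappa> \<in> (V - supp V \<sigma>) \<rightarrow>\<^sub>E ?B. proper_col (del_verts ends (supp V \<sigma>) E) ends pos \<kappa>}"
  have finV: "finite V" using sg by (simp add: signed_graph_def)
  have finL: "finite L" using L finite_subset by blast
  have fin\<Sigma>: "finite ?\<Sigma>" using finV finL by (simp add: finite_PiE)
  have finK: "finite (?K \<sigma>)" for \<sigma> using finV by (simp add: finite_PiE)
  \<comment> \<open>As \<open>n + 1\<close> is positive, the sign of an extreme colour is its
    label.\<close>
  have big_sgn: "x \<notin> ?B \<and> sgn x \<in> L \<and> x = ?N * sgn x" if "x \<in> (*) ?N ` L" for x
    using that L by (auto simp: sgn_mult)
  have cong_proper: "proper_col (del_verts ends (supp V \<sigma>) E) ends pos \<kappa>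
      \<longleftrightarrow> proper_col (del_verts ends (supp V \<sigma>) E) ends pos \<kappa>'"
    if "\<And>v. v \<in> V - supp V \<sigma> \<Longrightarrow> \<kappa> v = \<kappa>' v" for \<sigma> \<kappa> \<kappa>'
    using that sg unfolding proper_col_def del_verts_def signed_graph_def by auto
  have "col_sum V E ends pos ?A w
      = (\<Sum>(\<sigma>, \<kappa>)\<in>Sigma ?\<Sigma> ?K. r ^ card (supp V \<sigma>) * (\<Prod>v\<in>V - supp V \<sigma>. -1))"
    unfolding col_sum_def
  proof (rule sum.reindex_bij_witness[where j = "\<lambda>\<kappa>. (lab \<kappa>, restrict \<kappa> (V - supp V (lab \<kappa>)))"
        and i = "\<lambda>(\<sigma>, \<kappa>). join \<sigma> \<kappa>"])
    fix \<kappa> assume "\<kappa> \<in> {\<kappa> \<in> V \<rightarrow>\<^sub>E ?A. proper_col E ends pos \<kappa>}"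
    then have \<kappa>: "\<kappa> \<in> V \<rightarrow>\<^sub>E ?A" and pr: "proper_col E ends pos \<kappa>" by auto
    have cs: "(\<kappa> v \<in> ?B \<and> lab \<kappa> v = 0) \<or> (\<kappa> v \<in> (*) ?N ` L \<and> lab \<kappa> v \<in> L \<and> lab \<kappa> v \<noteq> 0 \<and> \<kappa> v = ?N * lab \<kappa> v)"
      if "v \<in> V" for v
    proof (cases "\<kappa> v \<in> ?B")
      case False
      then have "\<kappa> v \<in> (*) ?N ` L" using \<kappa> that by auto
      with big_sgn[of "\<kappa> v"] that False L show ?thesis unfolding lab_def by auto
    qed (use that in \<open>simp add: lab_def\<close>)
    have outside: "\<kappa> v = undefined" if "v \<notin> V" for v using \<kappa> that by auto
    show "(case (lab \<kappa>, restrict \<kappa> (V - supp V (lab \<kappa>))) of (\<sigma>, \<kappa>) \<Rightarrow> join \<sigma> \<kappa>) = \<kappa>"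
    proof (rule ext)
      fix v show "(case (lab \<kappa>, restrict \<kappa> (V - supp V (lab \<kappa>))) of (\<sigma>, \<kappa>) \<Rightarrow> join \<sigma> \<kappa>) v = \<kappa> v"
        using cs[of v] outside[of v] by (cases "v \<in> V") (auto simp: join_def supp_def)
    qed
    have lab_PiE: "lab \<kappa> \<in> V \<rightarrow>\<^sub>E insert 0 L"
    proof (rule PiE_I)
      show "lab \<kappa> v \<in> insert 0 L" if "v \<in> V" for v using cs[OF that] by blast
    qed (simp add: lab_def)
    have "proper_label E ends pos (lab \<kappa>) \<and> proper_col (del_verts ends (supp V (lab \<kappa>)) E) ends pos \<kappa>"
    proof (subst proper_col_join[OF sg, symmetric, where n = n])
      show "lab \<kappa> v \<in> {0, 1, -1}" if "v \<in> V" for v using cs[OF that] L by blast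
      show "\<kappa> v \<in> ?B" if "v \<in> V" "lab \<kappa> v = 0" for v using cs[OF that(1)] that(2) by blast
      show "\<kappa> v = ?N * lab \<kappa> v" if "v \<in> V" "lab \<kappa> v \<noteq> 0" for v using cs[OF that(1)] that(2) by blast
    qed (rule pr)
    moreover have "restrict \<kappa> (V - supp V (lab \<kappa>)) \<in> (V - supp V (lab \<kappa>)) \<rightarrow>\<^sub>E ?B"
    proof (rule restrict_PiE_iff[THEN iffD2], intro ballI)
      fix v assume "v \<in> V - supp V (lab \<kappa>)"
      then show "\<kappa> v \<in> ?B" using cs[of v] by (auto simp: supp_def)
    qed
    ultimately show "(lab \<kappa>, restrict \<kappa> (V - supp V (lab \<kappa>))) \<in> Sigma ?\<Sigma> ?K"
      using lab_PiE cong_proper[of "lab \<kappa>" "restrict \<kappa> (V - supp V (lab \<kappa>))" \<kappa>] by auto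
    have "(\<Prod>v\<in>V. w (\<kappa> v)) = (\<Prod>v\<in>supp V (lab \<kappa>). w (\<kappa> v)) * (\<Prod>v\<in>V - supp V (lab \<kappa>). w (\<kappa> v))"
      using finV by (subst prod.subset_diff[of "supp V (lab \<kappa>)"]) (auto simp: supp_def mult.commute)
    also have "(\<Prod>v\<in>supp V (lab \<kappa>). w (\<kappa> v)) = (\<Prod>v\<in>supp V (lab \<kappa>). r)"
    proof (intro prod.cong refl)
      fix v assume "v \<in> supp V (lab \<kappa>)"
      then have "lab \<kappa> v \<in> L" "\<kappa> v = ?N * lab \<kappa> v" using cs[of v] by (auto simp: supp_def)
      then show "w (\<kappa> v) = r" using big by simp
    qed
    also have "(\<Prod>v\<in>V - supp V (lab \<kappa>). w (\<kappa> v)) = (\<Prod>v\<in>V - supp V (lab \<kappa>). -1)"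
    proof (intro prod.cong refl)
      fix v assume "v \<in> V - supp V (lab \<kappa>)"
      then show "w (\<kappa> v) = -1" using cs[of v] small by (auto simp: supp_def)
    qed
    finally show "(case (lab \<kappa>, restrict \<kappa> (V - supp V (lab \<kappa>))) of
        (\<sigma>, \<kappa>) \<Rightarrow> r ^ card (supp V \<sigma>) * (\<Prod>v\<in>V - supp V \<sigma>. -1)) = (\<Prod>v\<in>V. w (\<kappa> v))"
      by simp
  next
    fix x assume "x \<in> Sigma ?\<Sigma> ?K"
    then obtain \<sigma> \<kappa> where x: "x = (\<sigma>, \<kappa>)" and \<sigma>: "\<sigma> \<in> V \<rightarrow>\<^sub>E insert 0 L"
      and ok: "proper_label E ends pos \<sigma>"
      and \<kappa>: "\<kappa> \<in> (V - supp V \<sigma>) \<rightarrow>\<^sub>E ?B"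
      and pr: "proper_col (del_verts ends (supp V \<sigma>) E) ends pos \<kappa>" by auto
    have cs: "(\<sigma> v = 0 \<and> \<kappa> v \<in> ?B \<and> join \<sigma> \<kappa> v = \<kappa> v) \<or>
        (\<sigma> v \<in> L \<and> \<sigma> v \<noteq> 0 \<and> join \<sigma> \<kappa> v = ?N * \<sigma> v)" if "v \<in> V" for v
    proof (cases "\<sigma> v = 0")
      case True
      then have "v \<in> V - supp V \<sigma>" using that by (simp add: supp_def)
      then have "\<kappa> v \<in> ?B" using \<kappa> by (rule PiE_mem[rotated])
      with True that show ?thesis by (simp add: join_def)
    next
      case False
      then show ?thesis using PiE_mem[OF \<sigma> that] that by (auto simp: join_def)
    qed
    have lab: "lab (join \<sigma> \<kappa>) = \<sigma>"
    proof (rule ext)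
      fix v show "lab (join \<sigma> \<kappa>) v = \<sigma> v"
      proof (cases "v \<in> V")
        case True
        from cs[OF True] show ?thesis
        proof
          assume "\<sigma> v \<in> L \<and> \<sigma> v \<noteq> 0 \<and> join \<sigma> \<kappa> v = ?N * \<sigma> v"
          then show ?thesis
            using True L big_sgn[of "?N * \<sigma> v"] by (auto simp: lab_def)
        qed (use True in \<open>simp add: lab_def\<close>)
      next
        case False
        then show ?thesis using \<sigma> by (auto simp: lab_def)
      qed
    qed
    have "restrict (join \<sigma> \<kappa>) (V - supp V \<sigma>) = \<kappa>"
    proof (rule ext)
      fix v show "restrict (join \<sigma> \<kappa>) (V - supp V \<sigma>) v = \<kappa> v"
        using \<kappa> by (cases "v \<in> V - supp V \<sigma>") (auto simp: join_def supp_def)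
    qed
    then show "(\<lambda>\<kappa>. (lab \<kappa>, restrict \<kappa> (V - supp V (lab \<kappa>)))) (case x of (\<sigma>, \<kappa>) \<Rightarrow> join \<sigma> \<kappa>) = x"
      using lab x by simp
    have "proper_col (del_verts ends (supp V \<sigma>) E) ends pos (join \<sigma> \<kappa>)"
      using pr cong_proper[of \<sigma> "join \<sigma> \<kappa>" \<kappa>] by (auto simp: join_def supp_def)
    then have "proper_col E ends pos (join \<sigma> \<kappa>)"
    proof (subst proper_col_join[OF sg, where n = n])
      show "\<sigma> v \<in> {0, 1, -1}" if "v \<in> V" for v using cs[OF that] L by blast
      show "join \<sigma> \<kappa> v \<in> ?B" if "v \<in> V" "\<sigma> v = 0" for v using cs[OF that(1)] that(2) by auto
      show "join \<sigma> \<kappa> v = ?N * \<sigma> v" if "v \<in> V" "\<sigma> v \<noteq> 0" for v using cs[OF that(1)] that(2) by blast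
    qed (use ok in simp)
    moreover have "join \<sigma> \<kappa> \<in> V \<rightarrow>\<^sub>E ?A"
    proof (rule PiE_I)
      show "join \<sigma> \<kappa> v \<in> ?A" if "v \<in> V" for v using cs[OF that] by auto
    qed (simp add: join_def)
    ultimately show "(case x of (\<sigma>, \<kappa>) \<Rightarrow> join \<sigma> \<kappa>) \<in> {\<kappa> \<in> V \<rightarrow>\<^sub>E ?A. proper_col E ends pos \<kappa>}"
      using x by simp
  qed
  also have "\<dots> = (\<Sum>\<sigma>\<in>?\<Sigma>. \<Sum>\<kappa>\<in>?K \<sigma>. r ^ card (supp V \<sigma>) * (\<Prod>v\<in>V - supp V \<sigma>. -1))"
    using fin\<Sigma> finK by (subst sum.Sigma) auto
  finally show ?thesis
    unfolding signed_col_count_def col_sum_def by (simp add: sum_distrib_left ac_simps)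
qed

section \<open>Acyclic orientations\<close>

definition opp :: "'e \<times> bool \<Rightarrow> 'e \<times> bool" where
  "opp h = (fst h, \<not> snd h)"

lemma two_arrows:
  assumes "fst a \<in> S" "fst b \<in> S" "hv ends a = v" "hv ends b = v" "\<tau> a \<noteq> \<tau> b"
  shows "(\<exists>h. fst h \<in> S \<and> hv ends h = v \<and> \<tau> h) \<and> (\<exists>h. fst h \<in> S \<and> hv ends h = v \<and> \<not> \<tau> h)"
proof (cases "\<tau> a")
  case True
  then have "\<not> \<tau> b" using assms(5) by simp
  with True show ?thesis using assms(1-4) by blast
next
  case False
  then have "\<tau> b" using assms(5) by simp
  with False show ?thesis using assms(1-4) by blast
qed

text \<open>If every arrow of F can be continued inside F at its vertex by an arrow of opposite kind, then
  iterating this choice on the finitely many half-edges of F eventually closes up to a cycle.\<close>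

lemma acyclic_ori_iff:
  assumes "finite E"
  shows "acyclic_ori E ends pos \<tau> \<longleftrightarrow> orientation E pos \<tau> \<and>
    (\<forall>F\<subseteq>E. F \<noteq> {} \<longrightarrow>
      (\<exists>h0. fst h0 \<in> F \<and> (\<forall>h. fst h \<in> F \<and> hv ends h = hv ends h0 \<longrightarrow> \<tau> h = \<tau> h0)))"
    (is "_ \<longleftrightarrow> _ \<and> ?unif")
proof -
  \<comment> \<open>The edge set of a cycle is a counterexample to \<open>?unif\<close>: each of its
    half-edges sits at a vertex of the walk, and there both kinds of arrow occur.\<close>
  have "\<not> ?unif" if cyc: "is_cycle E ends \<tau> es vs" for es vs
  proof -
    have es: "es \<noteq> []" "set es \<subseteq> E" and len: "length vs = length es"
      and walk: "\<And>i. i < length es \<Longrightarrow>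
        (fst (ends (es ! i)) = vs ! i \<and> snd (ends (es ! i)) = vs ! ((i + 1) mod length es)) \<or>
        (fst (ends (es ! i)) = vs ! ((i + 1) mod length es) \<and> snd (ends (es ! i)) = vs ! i)"
      using cyc unfolding is_cycle_def closed_walk_def Let_def by auto
    have mem: "hv ends h \<in> set vs" if h: "fst h \<in> set es" for h
    proof -
      obtain i where i: "i < length es" "es ! i = fst h" using h unfolding in_set_conv_nth by blast
      then have "(i + 1) mod length es < length es" using es by simp
      then have "vs ! i \<in> set vs" "vs ! ((i + 1) mod length es) \<in> set vs"
        using i len by simp_all
      then show ?thesis using walk[OF i(1)] i(2) unfolding hv_def by auto
    qed
    have "\<not> (\<forall>h. fst h \<in> set es \<and> hv ends h = hv ends h0 \<longrightarrow> \<tau> h = \<tau> h0)"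
      if h0: "fst h0 \<in> set es" for h0
    proof -
      obtain h h' where "fst h \<in> set es" "hv ends h = hv ends h0" "\<tau> h"
        "fst h' \<in> set es" "hv ends h' = hv ends h0" "\<not> \<tau> h'"
        using mem[OF h0] cyc unfolding is_cycle_def by blast
      then show ?thesis by (cases "\<tau> h0") blast+
    qed
    moreover have "set es \<noteq> {}" using es by simp
    ultimately show ?thesis using es(2) by blast
  qed
  moreover have "\<exists>es vs. is_cycle E ends \<tau> es vs" if nu: "\<not> ?unif"
  proof -
    obtain F where F: "F \<subseteq> E" "F \<noteq> {}"
      and no: "\<not> (\<exists>h0. fst h0 \<in> F \<and> (\<forall>h. fst h \<in> F \<and> hv ends h = hv ends h0 \<longrightarrow> \<tau> h = \<tau> h0))"
      using nu unfolding not_all not_imp by (elim exE conjE)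
    have turn: "\<exists>h. fst h \<in> F \<and> hv ends h = hv ends h0 \<and> \<tau> h \<noteq> \<tau> h0" if "fst h0 \<in> F" for h0
      using no that by blast
    \<comment> \<open>From \<open>h\<close> the walk crosses the edge to \<open>opp h\<close> and
      departs along a half-edge of \<open>F\<close> at that vertex whose arrow is of the other
      kind.\<close>
    obtain nx where nx: "\<And>h. fst h \<in> F \<Longrightarrow>
        fst (nx h) \<in> F \<and> hv ends (nx h) = hv ends (opp h) \<and> \<tau> (nx h) \<noteq> \<tau> (opp h)"
    proof -
      have "\<forall>h. \<exists>h'. fst h \<in> F \<longrightarrow>
          fst h' \<in> F \<and> hv ends h' = hv ends (opp h) \<and> \<tau> h' \<noteq> \<tau> (opp h)"
        using turn by (simp add: opp_def)
      then show ?thesis using that by metis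
    qed
    obtain e0 where "e0 \<in> F" using F by blast
    define H where "H i = (nx ^^ i) (e0, True)" for i
    have HF: "fst (H i) \<in> F" for i
      by (induction i) (use \<open>e0 \<in> F\<close> nx in \<open>auto simp: H_def\<close>)
    have H_Suc: "hv ends (H (Suc i)) = hv ends (opp (H i))" "\<tau> (H (Suc i)) \<noteq> \<tau> (opp (H i))" for i
      using nx[OF HF[of i]] by (simp_all add: H_def)
    have "range H \<subseteq> F \<times> UNIV" using HF by (simp add: image_subset_iff mem_Times_iff)
    moreover have "finite (F \<times> (UNIV :: bool set))"
      using finite_subset[OF F(1) assms] by simp
    ultimately have "finite (range H)" using finite_subset by blast
    then have "\<not> inj H" using finite_imageD by blast
    then obtain i j where ij: "i < j" "H i = H j"
      unfolding inj_def by (metis linorder_neqE_nat)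
    let ?es = "map (\<lambda>k. fst (H k)) [i..<j]" and ?vs = "map (\<lambda>k. hv ends (H k)) [i..<j]"
    have "closed_walk E ends ?es ?vs"
      unfolding closed_walk_def Let_def
    proof (intro conjI allI impI)
      fix k assume "k < length ?es"
      then have k: "k < j - i" by simp
      have x: "?vs ! k = hv ends (H (i + k))" and e: "?es ! k = fst (H (i + k))" using k by auto
      \<comment> \<open>The index wraps around at the last edge, whose successor half-edge
        \<open>H j\<close> equals \<open>H i\<close>.\<close>
      have y: "?vs ! ((k + 1) mod length ?es) = hv ends (opp (H (i + k)))"
      proof (cases "k + 1 = j - i")
        case True
        then have "j = Suc (i + k)" "(k + 1) mod length ?es = 0" using ij by simp_all
        moreover have "?vs ! 0 = hv ends (H i)" using ij by (simp del: upt_Suc)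
        ultimately show ?thesis using ij H_Suc(1)[of "i + k"] by (simp only:)
      next
        case False
        then show ?thesis using k H_Suc(1)[of "i + k"] by simp
      qed
      show "(fst (ends (?es ! k)) = ?vs ! k \<and>
              snd (ends (?es ! k)) = ?vs ! ((k + 1) mod length ?es)) \<or>
            (fst (ends (?es ! k)) = ?vs ! ((k + 1) mod length ?es) \<and>
              snd (ends (?es ! k)) = ?vs ! k)"
        unfolding x y e by (simp add: hv_def opp_def)
    qed (use ij HF F(1) in auto)
    moreover have "(\<exists>h. fst h \<in> set ?es \<and> hv ends h = v \<and> \<tau> h) \<and>
        (\<exists>h. fst h \<in> set ?es \<and> hv ends h = v \<and> \<not> \<tau> h)" if v: "v \<in> set ?vs" for v
    proof -
      obtain k where k: "i \<le> k" "k < j" "v = hv ends (H k)" using v by auto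
      \<comment> \<open>\<open>k'\<close> is the cyclic predecessor of \<open>k\<close>. The walk
        arrives at the vertex by \<open>opp (H k')\<close> and leaves by \<open>H k\<close>, and
        these two arrows differ in kind.\<close>
      define k' where "k' = (if k = i then j - 1 else k - 1)"
      have k': "i \<le> k'" "k' < j" "H k = H (Suc k')"
        using k ij by (auto simp: k'_def)
      have "fst (H k) \<in> set ?es" "fst (opp (H k')) \<in> set ?es"
        using k(1,2) k'(1,2) by (auto simp: opp_def)
      moreover have "hv ends (opp (H k')) = v" "\<tau> (H k) \<noteq> \<tau> (opp (H k'))"
        using k k' H_Suc by simp_all
      ultimately show ?thesis using k(3)
        by (intro two_arrows[of "H k" _ "opp (H k')"]) (simp_all only: not_False_eq_True)
    qed
    ultimately show ?thesis unfolding is_cycle_def by blast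
  qed
  ultimately show ?thesis unfolding acyclic_ori_def by blast
qed

lemma acyclic_ori_uniform:
  assumes "finite E" "acyclic_ori E ends pos \<tau>" "F \<subseteq> E" "F \<noteq> {}"
  shows "\<exists>h0. fst h0 \<in> F \<and> (\<forall>h. fst h \<in> F \<and> hv ends h = hv ends h0 \<longrightarrow> \<tau> h = \<tau> h0)"
  using assms(2-4) unfolding acyclic_ori_iff[OF assms(1)] by blast

lemma finite_orientations:
  assumes "finite E"
  shows "finite {\<tau>. acyclic_ori E ends pos \<tau>}"
proof -
  have "{\<tau>. acyclic_ori E ends pos \<tau>} \<subseteq> (\<lambda>S h. h \<in> S) ` Pow (E \<times> UNIV)"
  proof
    fix \<tau> assume "\<tau> \<in> {\<tau>. acyclic_ori E ends pos \<tau>}"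
    then have "{h. \<tau> h} \<in> Pow (E \<times> UNIV)" "\<tau> = (\<lambda>h. h \<in> {h. \<tau> h})"
      by (auto simp: acyclic_ori_def orientation_def)
    then show "\<tau> \<in> (\<lambda>S h. h \<in> S) ` Pow (E \<times> UNIV)" by blast
  qed
  then show ?thesis by (rule finite_subset[OF _ finite_imageI]) (simp add: assms)
qed

section \<open>Orientations with prescribed sinks and sources\<close>

definition num_acyclic :: "'e set \<Rightarrow> ('e \<Rightarrow> 'v \<times> 'v) \<Rightarrow> ('e \<Rightarrow> bool) \<Rightarrow> nat" where
  "num_acyclic E ends pos = card {\<tau>. acyclic_ori E ends pos \<tau>}"

text \<open>Label 1 prescribes a sink, label -1 a source.\<close>

definition fits :: "'e set \<Rightarrow> ('e \<Rightarrow> 'v \<times> 'v) \<Rightarrow> ('e \<times> bool \<Rightarrow> bool) \<Rightarrow> 'v \<Rightarrow> int \<Rightarrow> bool" where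
  "fits E ends \<tau> v l \<longleftrightarrow> (\<forall>h. fst h \<in> E \<and> hv ends h = v \<longrightarrow> \<tau> h = (l = 1))"

text \<open>This form treats the two half-edges of an edge symmetrically: the sign of the edge
  determines each arrow from the other.\<close>

lemma orientation_opp:
  "orientation E pos \<tau> \<longleftrightarrow> (\<forall>h. fst h \<notin> E \<longrightarrow> \<not> \<tau> h) \<and>
    (\<forall>h. fst h \<in> E \<longrightarrow> \<tau> (opp h) = (\<tau> h \<noteq> pos (fst h)))"
  unfolding orientation_def opp_def by (auto split: if_splits) (metis (full_types))+

text \<open>Labels force all arrows at labelled vertices, and through the edge signs also the
  opposite arrows. On edges between labelled vertices the forced arrows are consistent exactly when
  the labelling is proper. The remaining edges carry an arbitrary acyclic orientation, and forced
  sinks and sources create no cycle.\<close>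

lemma card_fitting_orientations:
  assumes sg: "signed_graph V E ends" and \<sigma>: "\<sigma> \<in> V \<rightarrow>\<^sub>E {0, 1, -1}"
  shows "card {\<tau>. acyclic_ori E ends pos \<tau> \<and> (\<forall>v\<in>V. \<sigma> v \<noteq> 0 \<longrightarrow> fits E ends \<tau> v (\<sigma> v))}
    = (if proper_label E ends pos \<sigma> then num_acyclic (del_verts ends (supp V \<sigma>) E) ends pos else 0)"
    (is "card ?T = _")
proof (cases "proper_label E ends pos \<sigma>")
  case False
  then obtain e where e: "e \<in> E" "\<sigma> (fst (ends e)) \<noteq> 0" "\<sigma> (snd (ends e)) \<noteq> 0"
    "\<sigma> (fst (ends e)) = (if pos e then 1 else -1) * \<sigma> (snd (ends e))"
    unfolding proper_label_def by blast
  have V: "fst (ends e) \<in> V" "snd (ends e) \<in> V" using sg e by (auto simp: signed_graph_def)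
  then have vals: "\<sigma> (fst (ends e)) \<in> {0, 1, -1}" "\<sigma> (snd (ends e)) \<in> {0, 1, -1}"
    using \<sigma> by (blast intro: PiE_mem)+
  have "\<tau> \<notin> ?T" for \<tau>
  proof
    assume "\<tau> \<in> ?T"
    then have ori: "orientation E pos \<tau>"
      and f: "fits E ends \<tau> (fst (ends e)) (\<sigma> (fst (ends e)))"
      "fits E ends \<tau> (snd (ends e)) (\<sigma> (snd (ends e)))"
      using e V by (auto simp: acyclic_ori_def)
    \<comment> \<open>The bad edge is positive with equal labels or negative with opposite labels;
      either way the prescribed arrows break the orientation rule.\<close>
    have "\<tau> (e, True) = (\<sigma> (fst (ends e)) = 1)" "\<tau> (e, False) = (\<sigma> (snd (ends e)) = 1)"
      using f e by (auto simp: fits_def hv_def)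
    moreover have "if pos e then \<tau> (e, True) \<noteq> \<tau> (e, False) else \<tau> (e, True) = \<tau> (e, False)"
      using ori e by (auto simp: orientation_def)
    ultimately show False using e vals by (auto split: if_splits)
  qed
  then have "?T = {}" by blast
  with False show ?thesis by (simp only: if_False card.empty)
next
  case True
  let ?E' = "del_verts ends (supp V \<sigma>) E"
  have finE: "finite E" using sg by (simp add: signed_graph_def)
  then have finE': "finite ?E'" by (simp add: del_verts_def)
  have hvV: "hv ends h \<in> V" if "fst h \<in> E" for h
    using sg that by (auto simp: signed_graph_def hv_def)
  have E': "fst h \<in> ?E' \<longleftrightarrow> fst h \<in> E \<and> \<sigma> (hv ends h) = 0 \<and> \<sigma> (hv ends (opp h)) = 0" for h
    using sg by (cases h; cases "snd h") (auto simp: del_verts_def supp_def hv_def opp_def signed_graph_def)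
  have vals: "\<sigma> (hv ends h) \<in> {0, 1, -1}" if "fst h \<in> E" for h
    using PiE_mem[OF \<sigma> hvV[OF that]] .
  have opp[simp]: "opp (opp h) = h" "fst (opp h) = fst h" for h by (simp_all add: opp_def)
  have agree: "(\<forall>v\<in>V. \<sigma> v \<noteq> 0 \<longrightarrow> fits E ends \<tau> v (\<sigma> v)) \<longleftrightarrow>
      (\<forall>h. fst h \<in> E \<longrightarrow> \<sigma> (hv ends h) \<noteq> 0 \<longrightarrow> \<tau> h = (\<sigma> (hv ends h) = 1))" for \<tau>
    using hvV unfolding fits_def by blast
  have label: "(\<sigma> (hv ends (opp h)) = 1) = ((\<sigma> (hv ends h) = 1) \<noteq> pos (fst h))"
    if "fst h \<in> E" "\<sigma> (hv ends h) \<noteq> 0" "\<sigma> (hv ends (opp h)) \<noteq> 0" for h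
  proof -
    obtain e b where h: "h = (e, b)" by (cases h)
    have "\<sigma> (fst (ends e)) \<noteq> (if pos e then 1 else -1) * \<sigma> (snd (ends e))"
      using True that h unfolding proper_label_def by (cases b) (auto simp: hv_def opp_def)
    then show ?thesis
      using that vals[of h] vals[of "opp h"] h
      by (cases b; cases "pos e") (auto simp: hv_def opp_def)
  qed
  define res where "res \<tau> = (\<lambda>h. fst h \<in> ?E' \<and> \<tau> h)" for \<tau> :: "'b \<times> bool \<Rightarrow> bool"
  \<comment> \<open>The forced extension: at a labelled vertex the label decides, and at an
    unlabelled vertex of a deleted edge the labelled opposite end decides through the sign.\<close>
  define ex where "ex \<tau> = (\<lambda>h. if fst h \<in> ?E' then \<tau> h else if fst h \<notin> E then False
      else if \<sigma> (hv ends h) \<noteq> 0 then \<sigma> (hv ends h) = 1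
      else (\<sigma> (hv ends (opp h)) = 1) \<noteq> pos (fst h))" for \<tau> :: "'b \<times> bool \<Rightarrow> bool"
  have "bij_betw res ?T {\<tau>. acyclic_ori ?E' ends pos \<tau>}"
  proof (rule bij_betw_byWitness[where f' = ex])
    show "\<forall>\<tau>\<in>?T. ex (res \<tau>) = \<tau>"
    proof (intro ballI ext)
      fix \<tau> h assume "\<tau> \<in> ?T"
      then have ori: "orientation E pos \<tau>"
        and ag: "\<And>h. fst h \<in> E \<Longrightarrow> \<sigma> (hv ends h) \<noteq> 0 \<Longrightarrow> \<tau> h = (\<sigma> (hv ends h) = 1)"
        unfolding agree by (auto simp: acyclic_ori_def)
      show "ex (res \<tau>) h = \<tau> h"
      proof -
        have "fst h \<notin> E \<Longrightarrow> \<not> \<tau> h" "fst h \<in> E \<Longrightarrow> \<tau> (opp h) = (\<tau> h \<noteq> pos (fst h))"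
          using ori unfolding orientation_opp by blast+
        then show ?thesis
          using ag[of h] ag[of "opp h"] E'[of h]
          by (cases "fst h \<in> E"; cases "\<sigma> (hv ends h) = 0"; cases "\<sigma> (hv ends (opp h)) = 0")
            (auto simp: ex_def res_def)
      qed
    qed
    show "\<forall>\<tau>\<in>{\<tau>. acyclic_ori ?E' ends pos \<tau>}. res (ex \<tau>) = \<tau>"
    proof (intro ballI ext)
      fix \<tau> h assume "\<tau> \<in> {\<tau>. acyclic_ori ?E' ends pos \<tau>}"
      then have "fst h \<notin> ?E' \<Longrightarrow> \<not> \<tau> h"
        unfolding acyclic_ori_def orientation_def by blast
      then show "res (ex \<tau>) h = \<tau> h" unfolding res_def ex_def by auto
    qed
    show "res ` ?T \<subseteq> {\<tau>. acyclic_ori ?E' ends pos \<tau>}"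
    proof (rule image_subsetI)
      fix \<tau> assume "\<tau> \<in> ?T"
      then have ac: "acyclic_ori E ends pos \<tau>" by simp
      have sub: "?E' \<subseteq> E" by (auto simp: del_verts_def)
      have "orientation ?E' pos (res \<tau>)"
        using ac sub unfolding acyclic_ori_def orientation_def res_def by (auto split: if_splits)
      moreover have "\<exists>h0. fst h0 \<in> F \<and>
          (\<forall>h. fst h \<in> F \<and> hv ends h = hv ends h0 \<longrightarrow> res \<tau> h = res \<tau> h0)"
        if F: "F \<subseteq> ?E'" "F \<noteq> {}" for F
      proof -
        have "F \<subseteq> E" using F sub by blast
        then obtain h0 where "fst h0 \<in> F"
          "\<forall>h. fst h \<in> F \<and> hv ends h = hv ends h0 \<longrightarrow> \<tau> h = \<tau> h0"
          using acyclic_ori_uniform[OF finE ac _ F(2)] by blast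
        then show ?thesis using F by (intro exI[of _ h0]) (auto simp: res_def)
      qed
      ultimately show "res \<tau> \<in> {\<tau>. acyclic_ori ?E' ends pos \<tau>}"
        unfolding acyclic_ori_iff[OF finE'] by blast
    qed
    show "ex ` {\<tau>. acyclic_ori ?E' ends pos \<tau>} \<subseteq> ?T"
    proof (rule image_subsetI)
      fix \<tau> assume "\<tau> \<in> {\<tau>. acyclic_ori ?E' ends pos \<tau>}"
      then have ac: "acyclic_ori ?E' ends pos \<tau>" by simp
      then have ori': "\<And>h. fst h \<in> ?E' \<Longrightarrow> \<tau> (opp h) = (\<tau> h \<noteq> pos (fst h))"
        unfolding acyclic_ori_def orientation_opp by blast
      have ag: "\<forall>h. fst h \<in> E \<longrightarrow> \<sigma> (hv ends h) \<noteq> 0 \<longrightarrow> ex \<tau> h = (\<sigma> (hv ends h) = 1)"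
        using E' by (auto simp: ex_def)
      have "ex \<tau> (opp h) = (ex \<tau> h \<noteq> pos (fst h))" if "fst h \<in> E" for h
        using ori'[of h] E'[of h] E'[of "opp h"] label[of h] that by (auto simp: ex_def)
      then have "orientation E pos (ex \<tau>)"
        unfolding orientation_opp by (auto simp: ex_def del_verts_def)
      moreover have "\<exists>h0. fst h0 \<in> F \<and>
          (\<forall>h. fst h \<in> F \<and> hv ends h = hv ends h0 \<longrightarrow> ex \<tau> h = ex \<tau> h0)"
        if F: "F \<subseteq> E" "F \<noteq> {}" for F
      \<comment> \<open>A labelled vertex met by \<open>F\<close> is uniform, since all its arrows
        equal the prescribed one. If there is none, \<open>F\<close> lies in the smaller
        graph.\<close>
      proof (cases "\<exists>h. fst h \<in> F \<and> \<sigma> (hv ends h) \<noteq> 0")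
        case True
        then obtain h0 where "fst h0 \<in> F" "\<sigma> (hv ends h0) \<noteq> 0" by blast
        then show ?thesis using ag F by (intro exI[of _ h0]) (metis subsetD)
      next
        case False
        then have FE': "F \<subseteq> ?E'"
          using F E'[of "(e, True)" for e] by (auto simp: opp_def)
        then obtain h0 where "fst h0 \<in> F"
          "\<forall>h. fst h \<in> F \<and> hv ends h = hv ends h0 \<longrightarrow> \<tau> h = \<tau> h0"
          using acyclic_ori_uniform[OF finE' ac _ F(2)] by blast
        then show ?thesis using FE' by (intro exI[of _ h0]) (auto simp: ex_def)
      qed
      ultimately show "ex \<tau> \<in> ?T"
        unfolding acyclic_ori_iff[OF finE] mem_Collect_eq agree using ag by blast
    qed
  qed
  then show ?thesis using True bij_betw_same_card by (auto simp: num_acyclic_def)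
qed

text \<open>Double counting of pairs of a labelling and an acyclic orientation that fits it. For a
  fixed orientation the labels are chosen independently at each vertex: label 0 contributes 1 and
  each fitting label contributes \<open>r\<close>.\<close>

lemma sum_labels_num_acyclic:
  fixes r :: rat
  assumes sg: "signed_graph V E ends" and L: "L \<subseteq> {1, -1}"
  shows "(\<Sum>\<sigma>\<in>{\<sigma> \<in> V \<rightarrow>\<^sub>E insert 0 L. proper_label E ends pos \<sigma>}.
      r ^ card (supp V \<sigma>) * of_nat (num_acyclic (del_verts ends (supp V \<sigma>) E) ends pos))
    = (\<Sum>\<tau>\<in>{\<tau>. acyclic_ori E ends pos \<tau>}.
        \<Prod>v\<in>V. 1 + r * of_nat (card {l \<in> L. fits E ends \<tau> v l}))"
proof -
  let ?\<Sigma> = "V \<rightarrow>\<^sub>E insert 0 L" and ?A = "{\<tau>. acyclic_ori E ends pos \<tau>}"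
  let ?ag = "\<lambda>\<sigma> \<tau>. \<forall>v\<in>V. \<sigma> v \<noteq> 0 \<longrightarrow> fits E ends \<tau> v (\<sigma> v)"
  \<comment> \<open>The local weight of label \<open>l\<close> at \<open>v\<close>; one label that
    does not fit makes the product over \<open>V\<close> zero, so the fitting condition becomes
    multiplicative.\<close>
  define g where "g \<tau> v l = (if l = 0 then 1 else if fits E ends \<tau> v l then r else 0)" for \<tau> v l
  have finV: "finite V" and finE: "finite E" using sg by (auto simp: signed_graph_def)
  have finL: "finite L" using L finite_subset by blast
  have fin\<Sigma>: "finite ?\<Sigma>" using finV finL by (simp add: finite_PiE)
  have finA: "finite ?A" using finite_orientations[OF finE] .
  have g: "(if ?ag \<sigma> \<tau> then r ^ card (supp V \<sigma>) else 0) = (\<Prod>v\<in>V. g \<tau> v (\<sigma> v))" for \<sigma> \<tau>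
  proof (cases "?ag \<sigma> \<tau>")
    case True
    have "(\<Prod>v\<in>V. g \<tau> v (\<sigma> v)) = (\<Prod>v\<in>V. if \<sigma> v \<noteq> 0 then r else 1)"
      using True by (intro prod.cong) (auto simp: g_def)
    also have "\<dots> = r ^ card (supp V \<sigma>)"
      using finV by (simp add: prod.inter_filter[symmetric] supp_def)
    finally show ?thesis using True by simp
  next
    case False
    then obtain v where "v \<in> V" "\<sigma> v \<noteq> 0" "\<not> fits E ends \<tau> v (\<sigma> v)" by blast
    then have "(\<Prod>v\<in>V. g \<tau> v (\<sigma> v)) = 0"
      using finV by (intro prod_zero) (auto simp: g_def)
    then show ?thesis using False by auto
  qed
  have "(\<Sum>\<sigma>\<in>{\<sigma> \<in> ?\<Sigma>. proper_label E ends pos \<sigma>}.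
      r ^ card (supp V \<sigma>) * of_nat (num_acyclic (del_verts ends (supp V \<sigma>) E) ends pos))
    = (\<Sum>\<sigma>\<in>?\<Sigma>. r ^ card (supp V \<sigma>) * of_nat (card {\<tau> \<in> ?A. ?ag \<sigma> \<tau>}))"
  \<comment> \<open>Improper labellings fit no acyclic orientation, so the sum may range over all
    labellings.\<close>
  proof (rule sum.mono_neutral_cong_left[OF fin\<Sigma>])
    have sub: "?\<Sigma> \<subseteq> V \<rightarrow>\<^sub>E {0, 1, -1}" using L by (intro PiE_mono) auto
    have eq: "card {\<tau> \<in> ?A. ?ag \<sigma> \<tau>} = (if proper_label E ends pos \<sigma>
        then num_acyclic (del_verts ends (supp V \<sigma>) E) ends pos else 0)" if "\<sigma> \<in> ?\<Sigma>" for \<sigma>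
      using card_fitting_orientations[OF sg, of \<sigma> pos] that sub by (simp add: subset_eq)
    show "\<forall>\<sigma>\<in>?\<Sigma> - {\<sigma> \<in> ?\<Sigma>. proper_label E ends pos \<sigma>}.
        r ^ card (supp V \<sigma>) * of_nat (card {\<tau> \<in> ?A. ?ag \<sigma> \<tau>}) = 0"
      using eq by auto
    show "r ^ card (supp V \<sigma>) * of_nat (num_acyclic (del_verts ends (supp V \<sigma>) E) ends pos)
        = r ^ card (supp V \<sigma>) * of_nat (card {\<tau> \<in> ?A. ?ag \<sigma> \<tau>})"
      if "\<sigma> \<in> {\<sigma> \<in> ?\<Sigma>. proper_label E ends pos \<sigma>}" for \<sigma>
      using eq[of \<sigma>] that by auto
  qed auto
  also have "\<dots> = (\<Sum>\<sigma>\<in>?\<Sigma>. \<Sum>\<tau>\<in>?A. if ?ag \<sigma> \<tau> then r ^ card (supp V \<sigma>) else 0)"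
  proof (intro sum.cong refl)
    fix \<sigma>
    have "(\<Sum>\<tau>\<in>?A. if ?ag \<sigma> \<tau> then r ^ card (supp V \<sigma>) else 0)
        = (\<Sum>\<tau>\<in>{\<tau> \<in> ?A. ?ag \<sigma> \<tau>}. r ^ card (supp V \<sigma>))"
      by (rule sum.inter_filter[OF finA, symmetric])
    then show "r ^ card (supp V \<sigma>) * of_nat (card {\<tau> \<in> ?A. ?ag \<sigma> \<tau>})
        = (\<Sum>\<tau>\<in>?A. if ?ag \<sigma> \<tau> then r ^ card (supp V \<sigma>) else 0)"
      by (simp only: sum_constant mult.commute)
  qed
  also have "\<dots> = (\<Sum>\<tau>\<in>?A. \<Sum>\<sigma>\<in>?\<Sigma>. \<Prod>v\<in>V. g \<tau> v (\<sigma> v))"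
    unfolding g by (rule sum.swap)
  \<comment> \<open>Distributivity: expanding the product picks one label per vertex.\<close>
  also have "\<dots> = (\<Sum>\<tau>\<in>?A. \<Prod>v\<in>V. \<Sum>l\<in>insert 0 L. g \<tau> v l)"
    using finV finL by (simp add: prod_sum_PiE)
  also have "(\<lambda>\<tau> v. \<Sum>l\<in>insert 0 L. g \<tau> v l)
      = (\<lambda>\<tau> v. 1 + r * of_nat (card {l \<in> L. fits E ends \<tau> v l}))"
  proof (intro ext)
    fix \<tau> v
    have "0 \<notin> L" using L by auto
    then have "(\<Sum>l\<in>insert 0 L. g \<tau> v l) = 1 + (\<Sum>l\<in>L. if fits E ends \<tau> v l then r else 0)"
      using finL by (auto simp: g_def intro!: sum.cong)
    then show "(\<Sum>l\<in>insert 0 L. g \<tau> v l) = 1 + r * of_nat (card {l \<in> L. fits E ends \<tau> v l})"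
      using finL by (simp add: sum.inter_filter[symmetric])
  qed
  finally show ?thesis .
qed

section \<open>Reciprocity\<close>

text \<open>If there are edges, some vertex has arrows, all of one kind; exactly one of the two
  labels fits there, and its factor \<open>1 - 1\<close> kills the product. Without edges both
  labels fit everywhere, so each factor is \<open>1 - 2\<close>.\<close>

lemma num_acyclic_alternating:
  assumes sg: "signed_graph V E ends"
  shows "(\<Sum>\<tau>\<in>{\<tau>. acyclic_ori E ends pos \<tau>}.
      \<Prod>v\<in>V. 1 + (-1) * of_nat (card {l \<in> {1, -1}. fits E ends \<tau> v l}))
    = (if E = {} then (-1) ^ card V else (0 :: rat))"
proof (cases "E = {}")
  case True
  have "{\<tau>. acyclic_ori {} ends pos \<tau>} = {\<lambda>h. False}"
    by (subst acyclic_ori_iff) (auto simp: orientation_def)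
  moreover have "{l \<in> {1, -1}. fits {} ends \<tau> v l} = {1, -1 :: int}" for \<tau> v
    by (auto simp: fits_def)
  ultimately show ?thesis using True by simp
next
  case False
  have finV: "finite V" and finE: "finite E" using sg by (auto simp: signed_graph_def)
  have "(\<Prod>v\<in>V. 1 + (-1) * of_nat (card {l \<in> {1, -1}. fits E ends \<tau> v l})) = (0 :: rat)"
    if \<tau>: "acyclic_ori E ends pos \<tau>" for \<tau>
  proof -
    obtain h0 where h0: "fst h0 \<in> E"
      "\<And>h. fst h \<in> E \<Longrightarrow> hv ends h = hv ends h0 \<Longrightarrow> \<tau> h = \<tau> h0"
      using acyclic_ori_uniform[OF finE \<tau> subset_refl False] by metis
    have fit: "fits E ends \<tau> (hv ends h0) l \<longleftrightarrow> \<tau> h0 = (l = 1)" for l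
      unfolding fits_def using h0 by metis
    have "{l \<in> {1, -1}. b = (l = 1)} = {if b then 1 else -1 :: int}" for b
      by (cases b) auto
    then have "1 + (-1) * of_nat (card {l \<in> {1, -1}. fits E ends \<tau> (hv ends h0) l}) = (0 :: rat)"
      unfolding fit by (simp only:) simp
    moreover have "hv ends h0 \<in> V" using sg h0(1) by (auto simp: signed_graph_def hv_def)
    ultimately show ?thesis using finV by (intro prod_zero) blast+
  qed
  then show ?thesis using False by simp
qed

text \<open>The signed-graph form of Stanley's reciprocity between colourings and acyclic
  orientations. Peeling off the colours \<open>n + 1\<close> and \<open>- (n + 1)\<close> expresses
  the difference in \<open>n\<close> through smaller vertex sets, so induction on
  \<open>card V\<close> applies.\<close>

lemma extrapolates_signed_col_count:
  assumes "signed_graph V E ends"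
  shows "extrapolates (signed_col_count V E ends pos) (of_nat (num_acyclic E ends pos))"
  using assms
proof (induction "card V" arbitrary: V E rule: less_induct)
  case less
  note sg = less.prems
  have finV: "finite V" using sg by (simp add: signed_graph_def)
  let ?\<Sigma> = "{\<sigma> \<in> V \<rightarrow>\<^sub>E insert 0 {1, -1}. proper_label E ends pos \<sigma>}"
  let ?del = "\<lambda>\<sigma>. del_verts ends (supp V \<sigma>) E"
  \<comment> \<open>The zero labelling, meaning that no vertex has an extreme colour, gives the term
    of the whole graph; every other term concerns strictly fewer vertices.\<close>
  define \<sigma>0 :: "'a \<Rightarrow> int" where "\<sigma>0 = (\<lambda>v\<in>V. 0)"
  have fin: "finite ?\<Sigma>" using finV by (simp add: finite_PiE)
  have supp0: "supp V \<sigma>0 = {}" by (simp add: supp_def \<sigma>0_def)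
  have \<sigma>0: "\<sigma>0 \<in> ?\<Sigma>"
    using sg by (auto simp: \<sigma>0_def proper_label_def signed_graph_def)
  have supp_nonempty: "supp V \<sigma> \<noteq> {}" if "\<sigma> \<in> ?\<Sigma> - {\<sigma>0}" for \<sigma>
  proof
    assume "supp V \<sigma> = {}"
    then have "\<sigma> v = \<sigma>0 v" for v
      using that by (cases "v \<in> V") (auto simp: supp_def \<sigma>0_def)
    then show False using that by auto
  qed
  define g where "g n = (\<Sum>\<sigma>\<in>?\<Sigma> - {\<sigma>0}. (-1) ^ card (supp V \<sigma>)
      * signed_col_count (V - supp V \<sigma>) (?del \<sigma>) ends pos n)" for n
  define d :: rat where "d = (\<Sum>\<sigma>\<in>?\<Sigma> - {\<sigma>0}. (-1) ^ card (supp V \<sigma>)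
      * of_nat (num_acyclic (?del \<sigma>) ends pos))"
  have "signed_col_count V E ends pos (Suc n) - signed_col_count V E ends pos n = g n" for n
  proof -
    have "{- int (Suc n)..int (Suc n)} = {- int n..int n} \<union> (*) (int n + 1) ` {1, -1}" by auto
    then have "signed_col_count V E ends pos (Suc n) = (\<Sum>\<sigma>\<in>?\<Sigma>. (-1) ^ card (supp V \<sigma>)
        * signed_col_count (V - supp V \<sigma>) (?del \<sigma>) ends pos n)"
      using col_sum_peel[OF sg, of "{1, -1}" n "\<lambda>_. -1" "-1" pos]
      by (simp add: signed_col_count_def)
    also have "\<dots> = signed_col_count V E ends pos n + g n"
      unfolding g_def by (subst sum.remove[OF fin \<sigma>0]) (simp add: supp0 del_verts_def)
    finally show ?thesis by simp
  qed
  moreover have "extrapolates g d"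
    unfolding g_def d_def
  proof (intro extrapolates_sum extrapolates_mult extrapolates_const)
    fix \<sigma> assume \<sigma>: "\<sigma> \<in> ?\<Sigma> - {\<sigma>0}"
    then have "card (V - supp V \<sigma>) < card V"
      using supp_nonempty[OF \<sigma>] finV by (intro psubset_card_mono) (auto simp: supp_def)
    then show "extrapolates (signed_col_count (V - supp V \<sigma>) (?del \<sigma>) ends pos)
        (of_nat (num_acyclic (?del \<sigma>) ends pos))"
      using less.hyps signed_graph_del_verts[OF sg] by blast
  qed (use fin in simp)
  ultimately have "extrapolates (signed_col_count V E ends pos)
      (signed_col_count V E ends pos 0 - d)"
    by (rule extrapolates_antidifference)
  \<comment> \<open>Adding \<open>d\<close> restores the full sum over labellings, which
    inclusion-exclusion evaluates; it must match the initial value at \<open>n = 0\<close>.\<close>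
  moreover have "signed_col_count V E ends pos 0 - d = of_nat (num_acyclic E ends pos)"
  proof -
    have "of_nat (num_acyclic E ends pos) + d = (\<Sum>\<sigma>\<in>?\<Sigma>. (-1) ^ card (supp V \<sigma>)
        * of_nat (num_acyclic (?del \<sigma>) ends pos))"
      unfolding d_def by (subst sum.remove[OF fin \<sigma>0]) (simp add: supp0 del_verts_def)
    also have "\<dots> = (\<Sum>\<tau>\<in>{\<tau>. acyclic_ori E ends pos \<tau>}.
        \<Prod>v\<in>V. 1 + (-1) * of_nat (card {l \<in> {1, -1}. fits E ends \<tau> v l}))"
      by (rule sum_labels_num_acyclic[OF sg]) simp
    also have "\<dots> = (if E = {} then (-1) ^ card V else 0)"
      by (rule num_acyclic_alternating[OF sg])
    also have "\<dots> = signed_col_count V E ends pos 0"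
    proof -
      \<comment> \<open>At \<open>n = 0\<close> the only colour is 0, and an edge of either sign
        forbids it at both ends.\<close>
      have "{\<kappa> \<in> V \<rightarrow>\<^sub>E {- int 0..int 0}. proper_col E ends pos \<kappa>} = (if E = {} then {\<sigma>0} else {})"
      proof -
        have "V \<rightarrow>\<^sub>E {- int 0..int 0} = {\<sigma>0}"
          using PiE_singleton[of \<sigma>0 V] by (simp add: \<sigma>0_def cong: PiE_cong)
        moreover have "proper_col E ends pos \<sigma>0 \<longleftrightarrow> E = {}"
          using sg by (auto simp: proper_col_def \<sigma>0_def signed_graph_def)
        ultimately show ?thesis by auto
      qed
      then show ?thesis unfolding signed_col_count_def col_sum_def by simp
    qed
    finally show ?thesis by simp
  qed
  ultimately show ?case by simp
qed

section \<open>Sinks and comparison of coefficients\<close>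

text \<open>Only label 1 occurs, because the alphabet has just one extreme colour. Its weight
  \<open>t - 1\<close> gives each sink the factor \<open>1 + (t - 1) = t\<close> and every other
  vertex the factor 1.\<close>

lemma extrapolates_chrom:
  assumes sg: "signed_graph V E ends" and "card V \<le> N"
  shows "extrapolates (\<lambda>n. ser_eval (alph n) (pt t n) N (chrom_B V E ends pos))
    (\<Sum>\<tau>\<in>{\<tau>. acyclic_ori E ends pos \<tau>}. t ^ num_sinks V E ends \<tau>)"
proof -
  have finV: "finite V" using sg by (simp add: signed_graph_def)
  let ?\<Sigma> = "{\<sigma> \<in> V \<rightarrow>\<^sub>E insert 0 {1}. proper_label E ends pos \<sigma>}"
  have eval: "ser_eval (alph n) (pt t n) N (chrom_B V E ends pos)
      = (\<Sum>\<sigma>\<in>?\<Sigma>. (t - 1) ^ card (supp V \<sigma>)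
        * signed_col_count (V - supp V \<sigma>) (del_verts ends (supp V \<sigma>) E) ends pos n)" for n
  proof -
    have "ser_eval (alph n) (pt t n) N (chrom_B V E ends pos) = col_sum V E ends pos (alph n) (pt t n)"
      by (rule ser_eval_chrom[OF finV _ assms(2)]) (simp add: alph_def)
    also have "\<dots> = (\<Sum>\<sigma>\<in>?\<Sigma>. (t - 1) ^ card (supp V \<sigma>)
        * signed_col_count (V - supp V \<sigma>) (del_verts ends (supp V \<sigma>) E) ends pos n)"
    proof -
      have "alph n = {- int n..int n} \<union> (*) (int n + 1) ` {1}" by (simp add: alph_def)
      then show ?thesis
        by (simp only:) (rule col_sum_peel[OF sg], auto simp: pt_def)
    qed
    finally show ?thesis .
  qed
  have extr: "extrapolates (\<lambda>n. \<Sum>\<sigma>\<in>?\<Sigma>. (t - 1) ^ card (supp V \<sigma>)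
        * signed_col_count (V - supp V \<sigma>) (del_verts ends (supp V \<sigma>) E) ends pos n)
      (\<Sum>\<sigma>\<in>?\<Sigma>. (t - 1) ^ card (supp V \<sigma>)
        * of_nat (num_acyclic (del_verts ends (supp V \<sigma>) E) ends pos))"
  proof (intro extrapolates_sum extrapolates_mult extrapolates_const)
    show "extrapolates (signed_col_count (V - supp V \<sigma>) (del_verts ends (supp V \<sigma>) E) ends pos)
        (of_nat (num_acyclic (del_verts ends (supp V \<sigma>) E) ends pos))" for \<sigma>
      by (rule extrapolates_signed_col_count[OF signed_graph_del_verts[OF sg]])
  qed (use finV in \<open>simp add: finite_PiE\<close>)
  have sinks: "(\<Prod>v\<in>V. 1 + (t - 1) * of_nat (card {l \<in> {1}. fits E ends \<tau> v l}))
      = t ^ num_sinks V E ends \<tau>" for \<tau>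
  proof -
    have "(\<Prod>v\<in>V. 1 + (t - 1) * of_nat (card {l \<in> {1}. fits E ends \<tau> v l}))
        = (\<Prod>v\<in>V. if is_sink V E ends \<tau> v then t else 1)"
    proof (intro prod.cong refl)
      fix v assume "v \<in> V"
      then have "fits E ends \<tau> v 1 \<longleftrightarrow> is_sink V E ends \<tau> v"
        unfolding fits_def is_sink_def by simp
      then have "{l \<in> {1 :: int}. fits E ends \<tau> v l} = (if is_sink V E ends \<tau> v then {1} else {})"
        by auto
      then show "1 + (t - 1) * of_nat (card {l \<in> {1}. fits E ends \<tau> v l})
          = (if is_sink V E ends \<tau> v then t else 1)"
        by (simp only:) simp
    qed
    also have "\<dots> = t ^ num_sinks V E ends \<tau>"
      using finV by (simp add: prod.inter_filter[symmetric] num_sinks_def)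
    finally show ?thesis .
  qed
  have "(\<Sum>\<sigma>\<in>?\<Sigma>. (t - 1) ^ card (supp V \<sigma>)
        * of_nat (num_acyclic (del_verts ends (supp V \<sigma>) E) ends pos))
      = (\<Sum>\<tau>\<in>{\<tau>. acyclic_ori E ends pos \<tau>}. t ^ num_sinks V E ends \<tau>)"
    unfolding sinks[symmetric] by (rule sum_labels_num_acyclic[OF sg]) simp
  with eval extr show ?thesis by (simp only:)
qed

theorem theorem3p1:
  fixes V :: "'v set" and E :: "'e set" and ends :: "'e \<Rightarrow> 'v \<times> 'v"
    and pos :: "'e \<Rightarrow> bool" and P :: "gen multiset \<Rightarrow> rat" and k :: nat
  assumes "signed_graph V E ends"
    and "finite {M. P M \<noteq> 0}"
    and "\<forall>M. P M \<noteq> 0 \<longrightarrow> (\<forall>g\<in>#M. valid_gen g)"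
    and "poly_eval P = chrom_B V E ends pos"
  shows "of_nat (card {\<tau>. acyclic_ori E ends pos \<tau> \<and> num_sinks V E ends \<tau> = k})
         = (\<Sum>M\<in>{M. P M \<noteq> 0 \<and> num_e M = k}. P M)"
proof -
  let ?S = "{M. P M \<noteq> 0}" and ?A = "{\<tau>. acyclic_ori E ends pos \<tau>}"
  have "finite E" using assms(1) by (simp add: signed_graph_def)
  then have finA: "finite ?A" by (rule finite_orientations)
  \<comment> \<open>One cutoff large enough for the chromatic series and for every monomial of
    \<open>P\<close> at once.\<close>
  define N where "N = card V + (\<Sum>M\<in>?S. mono_deg M)"
  \<comment> \<open>\<open>p\<close> and \<open>q\<close> are the generating polynomials in
    \<open>t\<close> of the two sides of the claim, by number of \<open>GE\<close> factors and by
    number of sinks.\<close>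
  define p where "p = (\<Sum>M\<in>?S. monom (P M) (num_e M))"
  define q where "q = (\<Sum>\<tau>\<in>?A. monom (1 :: rat) (num_sinks V E ends \<tau>))"
  have "poly p t = poly q t" for t
  proof -
    have "ser_eval (alph n) (pt t n) N (poly_eval P)
        = (\<Sum>M\<in>?S. P M * ser_eval (alph n) (pt t n) N (gen_mono_ser M))" for n
      unfolding ser_eval_def poly_eval_def sum_distrib_left sum_distrib_right
      by (subst sum.swap) (simp add: mult.assoc)
    moreover have "extrapolates
        (\<lambda>n. \<Sum>M\<in>?S. P M * ser_eval (alph n) (pt t n) N (gen_mono_ser M))
        (\<Sum>M\<in>?S. P M * t ^ num_e M)"
    proof (intro extrapolates_sum extrapolates_mult extrapolates_const extrapolates_gen_mono)
      fix M assume "M \<in> ?S"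
      then show "\<forall>g\<in>#M. valid_gen g" "mono_deg M \<le> N"
        using assms(2,3) member_le_sum[of M ?S mono_deg] by (auto simp: N_def)
    qed (rule assms(2))
    ultimately have "extrapolates (\<lambda>n. ser_eval (alph n) (pt t n) N (chrom_B V E ends pos))
        (\<Sum>M\<in>?S. P M * t ^ num_e M)"
      using assms(4) by simp
    from extrapolates_unique[OF this extrapolates_chrom[OF assms(1)]]
    show ?thesis by (simp add: N_def p_def q_def poly_sum poly_monom)
  qed
  \<comment> \<open>Agreement at every rational \<open>t\<close> gives equality of polynomials, so
    the claim for each \<open>k\<close> is a comparison of coefficients.\<close>
  then have "p = q" by (simp add: poly_eq_poly_eq_iff[symmetric] fun_eq_iff)
  then have "coeff p k = coeff q k" by simp
  moreover have "coeff p k = (\<Sum>M\<in>{M. P M \<noteq> 0 \<and> num_e M = k}. P M)"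
    using sum.inter_filter[OF assms(2), of P "\<lambda>M. num_e M = k"]
    by (simp add: p_def coeff_sum)
  moreover have "coeff q k = of_nat (card {\<tau>. acyclic_ori E ends pos \<tau> \<and> num_sinks V E ends \<tau> = k})"
    using sum.inter_filter[OF finA, of "\<lambda>_. 1 :: rat" "\<lambda>\<tau>. num_sinks V E ends \<tau> = k"]
    by (simp add: q_def coeff_sum)
  ultimately show ?thesis by simp
qed

end
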